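(* Let $(E,\mathcal T)$ be a real $L^0$-pre-barreled module such that $E$ has the countable concatenation property. Then, for a proper lower semicontinuous $L^0$-convex function $f:E\to\bar L^0(\mathcal F)$, $\partial f(x)\neq\emptyset$ for all $x\in\mathrm{Int}(\mathrm{dom}(f))$, the interior of $\mathrm{dom}(f)$.
   Context: $(\Omega,\mathcal F,P)$ is a probability space. $L^0(\mathcal F)$ is the algebra of (a.s.-equality) equivalence classes of real $\mathcal F$-measurable random variables with the a.s. order; $L^0_+(\mathcal F)$ and $L^0_{++}(\mathcal F)$ are its elements that are $\ge0$, respectively $>0$, a.s. $\bar L^0(\mathcal F)$ is the complete lattice of classes of $[-\infty,\infty]$-valued $\mathcal F$-measurable functions. $\tilde I_A$ is the class of the indicator of $A\in\mathcal F$. Conventions: $0\cdot(\pm\infty)=0$, $+\infty\pm(\pm\infty)=+\infty$. $\mathcal T_c$ on $L^0(\mathcal F)$: $G$ is open iff for each $x\in G$ there is $\varepsilon\in L^0_{++}(\mathcal F)$ with $\{y:|y-x|\le\varepsilon\}\subset G$; this makes $L^0(\mathcal F)$ a topological ring. Standing assumption on all $L^0(\mathcal F)$-modules $E$: if $x,y\in E$ and $\tilde I_{A_n}x=\tilde I_{A_n}y$ for all $n$ for some countable partition $\{A_n\}$ of $\Omega$ into sets of $\mathcal F$, then $x=y$. In an $L^0(\mathcal F)$-module $E$: a set $B$ is $L^0$-balanced if $\eta B\subset B$ for all $\eta\in L^0(\mathcal F)$ with $|\eta|\le1$; $L^0$-convex if $\xi x+(1-\xi)y\in B$ for $x,y\in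 B$, $\xi\in L^0_+(\mathcal F)$, $0\le\xi\le1$; $L^0$-absorbent if for every $x\in E$ there is $\xi\in L^0_{++}(\mathcal F)$ with $\eta x\in B$ for all $\eta\in L^0(\mathcal F)$, $|\eta|\le\xi$. A (real) locally $L^0$-convex module is a pair $(E,\mathcal T)$ where $E$ is an $L^0(\mathcal F)$-module and $\mathcal T$ a topology on $E$ making addition $E\times E\to E$ and module multiplication $(L^0(\mathcal F),\mathcal T_c)\times E\to E$ jointly continuous and having a local base at $\theta$ (the null element) of $L^0$-balanced, $L^0$-absorbent, $L^0$-convex sets. $E^*_c$ is the module of continuous module homomorphisms from $(E,\mathcal T)$ to $(L^0(\mathcal F),\mathcal T_c)$. An $L^0$-barrel is an $L^0$-balanced, $L^0$-absorbent, $L^0$-convex and closed set. A set $G\subset E$ (possibly $G=E$) has the countable concatenation property if for every sequence $\{x_n\}$ in $G$ and countable partition $\{A_n\}$ of $\Omega$ into sets of $\mathcal F$ there is $x\in G$ with $\tilde I_{A_n}x=\tilde I_{A_n}x_n$ for all $n$. A locally $L^0$-convex module is an $L^0$-pre-barreled module if every $L^0$-barrel with the countable concatenation property is a neighborhood of $\theta$. For $f:E\to\bar L^0(\mathcal F)$: $\mathrm{dom}(f)=\{x\in E:|f(x)|<+\infty\text{ a.s.}\}$; $f$ is proper if $\mathrm{dom}(f)\ne\emptyset$ and $f(x)>-\infty$ a.s. for all $x$; $f$ is $L^0$-convex if $f(\xi x+(1-\xi)y)\le\xi f(x)+(1-\xi)f(y)$ for $x,y\in E$, $\xi\in L^0_+(\mathcal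 F)$, $0\le\xi\le1$; a proper $f$ is lower semicontinuous if $\{x:f(x)\le r\}$ is closed for every $r\in L^0(\mathcal F)$. For a proper $L^0$-convex $f$ and $x\in\mathrm{dom}(f)$, $\partial f(x)=\{u\in E^*_c: u(y-x)\le f(y)-f(x)\text{ for all }y\in E\}$ is the set of subgradients of $f$ at $x$. *)

theory Defs
  imports "HOL-Algebra.Module" "HOL-Probability.Probability"
begin

section \<open>Classes of random variables\<close>

definition ae_class :: "'w measure \<Rightarrow> ('w \<Rightarrow> 'b::topological_space) \<Rightarrow> ('w \<Rightarrow> 'b) set" where
  "ae_class M f = {g \<in> borel_measurable M. AE w in M. g w = f w}"

text \<open>The value type \<open>real\<close> gives the carrier of $L^0$, the value type \<open>ereal\<close> gives $\bar L^0$.\<close>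

definition L0_space :: "'w measure \<Rightarrow> ('w \<Rightarrow> 'b::topological_space) set set" where
  "L0_space M = ae_class M ` borel_measurable M"

definition L0_map ::
  "'w measure \<Rightarrow> ('b \<Rightarrow> 'c) \<Rightarrow> ('w \<Rightarrow> 'b) set \<Rightarrow> ('w \<Rightarrow> 'c::topological_space) set" where
  "L0_map M h X = {k \<in> borel_measurable M. \<exists>f\<in>X. AE w in M. k w = h (f w)}"

definition L0_map2 ::
  "'w measure \<Rightarrow> ('b \<Rightarrow> 'c \<Rightarrow> 'd) \<Rightarrow> ('w \<Rightarrow> 'b) set \<Rightarrow> ('w \<Rightarrow> 'c) set
    \<Rightarrow> ('w \<Rightarrow> 'd::topological_space) set" where
  "L0_map2 M h X Y = {k \<in> borel_measurable M. \<exists>f\<in>X. \<exists>g\<in>Y. AE w in M. k w = h (f w) (g w)}"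

definition L0_rel ::
  "'w measure \<Rightarrow> ('b \<Rightarrow> 'c \<Rightarrow> bool) \<Rightarrow> ('w \<Rightarrow> 'b) set \<Rightarrow> ('w \<Rightarrow> 'c) set \<Rightarrow> bool" where
  "L0_rel M R X Y \<longleftrightarrow> (\<exists>f\<in>X. \<exists>g\<in>Y. AE w in M. R (f w) (g w))"

abbreviation L0_le ::
  "'w measure \<Rightarrow> ('w \<Rightarrow> 'b::ord) set \<Rightarrow> ('w \<Rightarrow> 'b) set \<Rightarrow> bool" where
  "L0_le M \<equiv> L0_rel M (\<le>)"

abbreviation L0_less ::
  "'w measure \<Rightarrow> ('w \<Rightarrow> 'b::ord) set \<Rightarrow> ('w \<Rightarrow> 'b) set \<Rightarrow> bool" where
  "L0_less M \<equiv> L0_rel M (<)"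

definition L0 :: "'w measure \<Rightarrow> ('w \<Rightarrow> real) set ring" where
  "L0 M = \<lparr>carrier = L0_space M, monoid.mult = L0_map2 M (*), one = ae_class M (\<lambda>_. 1),
           zero = ae_class M (\<lambda>_. 0), add = L0_map2 M (+)\<rparr>"

definition L0_pos :: "'w measure \<Rightarrow> ('w \<Rightarrow> real) set set" where
  "L0_pos M = {\<xi> \<in> carrier (L0 M). L0_le M \<zero>\<^bsub>L0 M\<^esub> \<xi>}"

definition L0_spos :: "'w measure \<Rightarrow> ('w \<Rightarrow> real) set set" where
  "L0_spos M = {\<xi> \<in> carrier (L0 M). L0_less M \<zero>\<^bsub>L0 M\<^esub> \<xi>}"

definition L0_abs :: "'w measure \<Rightarrow> ('w \<Rightarrow> real) set \<Rightarrow> ('w \<Rightarrow> real) set" where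
  "L0_abs M = L0_map M abs"

definition L0_indicator :: "'w measure \<Rightarrow> 'w set \<Rightarrow> ('w \<Rightarrow> real) set" where
  "L0_indicator M A = ae_class M (indicator A)"

definition L0_embed :: "'w measure \<Rightarrow> ('w \<Rightarrow> real) set \<Rightarrow> ('w \<Rightarrow> ereal) set" where
  "L0_embed M = L0_map M ereal"

text \<open>
  The arithmetic of \<open>ereal\<close> already follows the conventions $0\cdot(\pm\infty) = 0$ and
  $+\infty\pm(\pm\infty) = +\infty$.
\<close>

lemma ereal_conventions:
  "0 * (\<infinity>::ereal) = 0" "0 * (-\<infinity>::ereal) = 0"
  "(\<infinity>::ereal) + \<infinity> = \<infinity>" "(\<infinity>::ereal) + -\<infinity> = \<infinity>"
  "(\<infinity>::ereal) - \<infinity> = \<infinity>" "(\<infinity>::ereal) - -\<infinity> = \<infinity>"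
  by simp_all

lemma ae_class_self [simp]: "f \<in> borel_measurable M \<Longrightarrow> f \<in> ae_class M f"
  by (simp add: ae_class_def)

lemma ae_class_eq_iff:
  assumes "f \<in> borel_measurable M" "g \<in> borel_measurable M"
  shows "ae_class M f = ae_class M g \<longleftrightarrow> (AE w in M. f w = g w)"
proof
  assume "ae_class M f = ae_class M g"
  then have "f \<in> ae_class M g" using assms ae_class_self by blast
  then show "AE w in M. f w = g w" by (simp add: ae_class_def)
next
  assume *: "AE w in M. f w = g w"
  have "(AE w in M. h w = f w) \<longleftrightarrow> (AE w in M. h w = g w)" for h :: "'a \<Rightarrow> 'b"
    using * by (auto elim: eventually_elim2)
  then show "ae_class M f = ae_class M g" by (simp add: ae_class_def)
qed

lemma L0_map_ae_class:
  assumes "f \<in> borel_measurable M"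
  shows "L0_map M h (ae_class M f) = ae_class M (\<lambda>w. h (f w))"
proof -
  have "(\<exists>f'\<in>ae_class M f. AE w in M. k w = h (f' w)) \<longleftrightarrow> (AE w in M. k w = h (f w))" for k
  proof
    assume "\<exists>f'\<in>ae_class M f. AE w in M. k w = h (f' w)"
    then obtain f' where "AE w in M. f' w = f w" "AE w in M. k w = h (f' w)"
      by (auto simp: ae_class_def)
    then show "AE w in M. k w = h (f w)" by eventually_elim simp
  qed (use assms in auto)
  then show ?thesis by (simp add: L0_map_def ae_class_def)
qed

lemma L0_map2_ae_class:
  assumes "f \<in> borel_measurable M" "g \<in> borel_measurable M"
  shows "L0_map2 M h (ae_class M f) (ae_class M g) = ae_class M (\<lambda>w. h (f w) (g w))"
proof -
  have "(\<exists>f'\<in>ae_class M f. \<exists>g'\<in>ae_class M g. AE w in M. k w = h (f' w) (g' w))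
      \<longleftrightarrow> (AE w in M. k w = h (f w) (g w))" for k
  proof
    assume "\<exists>f'\<in>ae_class M f. \<exists>g'\<in>ae_class M g. AE w in M. k w = h (f' w) (g' w)"
    then obtain f' g' where "AE w in M. f' w = f w" "AE w in M. g' w = g w"
        "AE w in M. k w = h (f' w) (g' w)"
      by (auto simp: ae_class_def)
    then show "AE w in M. k w = h (f w) (g w)" by eventually_elim simp
  next
    assume "AE w in M. k w = h (f w) (g w)"
    then show "\<exists>f'\<in>ae_class M f. \<exists>g'\<in>ae_class M g. AE w in M. k w = h (f' w) (g' w)"
      using assms by (intro bexI[of _ f] bexI[of _ g]) auto
  qed
  then show ?thesis by (simp add: L0_map2_def ae_class_def)
qed

lemma L0_rel_ae_class:
  assumes "f \<in> borel_measurable M" "g \<in> borel_measurable M"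
  shows "L0_rel M R (ae_class M f) (ae_class M g) \<longleftrightarrow> (AE w in M. R (f w) (g w))"
proof
  assume "L0_rel M R (ae_class M f) (ae_class M g)"
  then obtain f' g' where "AE w in M. f' w = f w" "AE w in M. g' w = g w"
      "AE w in M. R (f' w) (g' w)"
    by (auto simp: L0_rel_def ae_class_def)
  then show "AE w in M. R (f w) (g w)" by eventually_elim simp
next
  assume "AE w in M. R (f w) (g w)"
  then show "L0_rel M R (ae_class M f) (ae_class M g)"
    unfolding L0_rel_def using assms by (intro bexI[of _ f] bexI[of _ g]) auto
qed

lemma L0_cring: "cring (L0 M)"
proof (intro cringI abelian_groupI comm_monoidI)
  fix x assume "x \<in> carrier (L0 M)"
  then obtain f where f: "f \<in> borel_measurable M" "x = ae_class M f"
    by (auto simp: L0_def L0_space_def)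
  then show "\<exists>y\<in>carrier (L0 M). y \<oplus>\<^bsub>L0 M\<^esub> x = \<zero>\<^bsub>L0 M\<^esub>"
    by (auto simp: L0_def L0_space_def L0_map2_ae_class
        intro!: bexI[of _ "\<lambda>w. - f w"])
qed (auto simp: L0_def L0_space_def L0_map2_ae_class algebra_simps)

section \<open>The topology on the ring of coefficients\<close>

definition L0_cball ::
  "'w measure \<Rightarrow> ('w \<Rightarrow> real) set \<Rightarrow> ('w \<Rightarrow> real) set \<Rightarrow> ('w \<Rightarrow> real) set set" where
  "L0_cball M x \<epsilon> = {y \<in> carrier (L0 M). L0_le M (L0_abs M (y \<ominus>\<^bsub>L0 M\<^esub> x)) \<epsilon>}"

definition L0_topology :: "'w measure \<Rightarrow> ('w \<Rightarrow> real) set topology" where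
  "L0_topology M = topology (\<lambda>G. G \<subseteq> carrier (L0 M) \<and>
     (\<forall>x\<in>G. \<exists>\<epsilon>\<in>L0_spos M. L0_cball M x \<epsilon> \<subseteq> G))"

lemma L0_minus_ae_class:
  assumes f: "f \<in> borel_measurable M" and g: "g \<in> borel_measurable M"
  shows "ae_class M f \<ominus>\<^bsub>L0 M\<^esub> ae_class M g = ae_class M (\<lambda>w. f w - g w)"
proof -
  interpret cring "L0 M" by (rule L0_cring)
  have "\<ominus>\<^bsub>L0 M\<^esub> ae_class M g = ae_class M (\<lambda>w. - g w)"
    by (rule minus_equality)
      (use g in \<open>auto simp: L0_def L0_space_def L0_map2_ae_class\<close>)
  then show ?thesis
    using f g by (simp add: a_minus_def) (simp add: L0_def L0_map2_ae_class)
qed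

lemma openin_L0_topology:
  "openin (L0_topology M) G \<longleftrightarrow>
     G \<subseteq> carrier (L0 M) \<and> (\<forall>x\<in>G. \<exists>\<epsilon>\<in>L0_spos M. L0_cball M x \<epsilon> \<subseteq> G)"
proof -
  let ?P = "\<lambda>G. G \<subseteq> carrier (L0 M) \<and> (\<forall>x\<in>G. \<exists>\<epsilon>\<in>L0_spos M. L0_cball M x \<epsilon> \<subseteq> G)"
  have min: "\<exists>\<epsilon>\<in>L0_spos M. L0_cball M x \<epsilon> \<subseteq> L0_cball M x \<epsilon>1 \<inter> L0_cball M x \<epsilon>2"
    if x: "x \<in> carrier (L0 M)" and e: "\<epsilon>1 \<in> L0_spos M" "\<epsilon>2 \<in> L0_spos M" for x \<epsilon>1 \<epsilon>2
  proof -
    from x e obtain f g h where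
        m [measurable]: "f \<in> borel_measurable M" "g \<in> borel_measurable M" "h \<in> borel_measurable M"
        and eq: "x = ae_class M f" "\<epsilon>1 = ae_class M g" "\<epsilon>2 = ae_class M h"
      by (auto simp: L0_spos_def L0_def L0_space_def)
    have pos: "AE w in M. 0 < g w" "AE w in M. 0 < h w"
      using e by (auto simp: L0_spos_def L0_def eq L0_rel_ae_class)
    let ?e = "ae_class M (\<lambda>w. min (g w) (h w))"
    have "?e \<in> L0_spos M"
      using pos by (auto simp: L0_spos_def L0_def L0_space_def L0_rel_ae_class)
    moreover have "L0_cball M x ?e \<subseteq> L0_cball M x \<epsilon>1 \<inter> L0_cball M x \<epsilon>2"
    proof
      fix y assume y: "y \<in> L0_cball M x ?e"
      then obtain k where [measurable]: "k \<in> borel_measurable M" and k: "y = ae_class M k"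
        by (auto simp: L0_cball_def L0_def L0_space_def)
      show "y \<in> L0_cball M x \<epsilon>1 \<inter> L0_cball M x \<epsilon>2"
        using y by (auto simp: L0_cball_def k eq L0_minus_ae_class L0_abs_def L0_map_ae_class
            L0_rel_ae_class elim!: eventually_mono)
    qed
    ultimately show ?thesis by blast
  qed
  have Int: "?P (S \<inter> T)" if S: "?P S" and T: "?P T" for S T
  proof (intro conjI ballI)
    fix x assume x: "x \<in> S \<inter> T"
    then obtain \<epsilon>1 \<epsilon>2 where "\<epsilon>1 \<in> L0_spos M" "\<epsilon>2 \<in> L0_spos M"
        "L0_cball M x \<epsilon>1 \<subseteq> S" "L0_cball M x \<epsilon>2 \<subseteq> T"
      using S T by blast
    with min[of x \<epsilon>1 \<epsilon>2] x S show "\<exists>\<epsilon>\<in>L0_spos M. L0_cball M x \<epsilon> \<subseteq> S \<inter> T"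
      by (meson IntE Int_mono order_trans subsetD)
  qed (use S in auto)
  have Un: "?P (\<Union>K)" if "\<forall>S\<in>K. ?P S" for K
    using that by (meson UnionE Union_least Union_upper order_trans)
  have "istopology ?P"
    unfolding istopology_def using Int Un by blast
  then show ?thesis by (simp add: L0_topology_def topology_inverse')
qed

section \<open>Modules over the ring of random variables\<close>

text \<open>Members of the partition may be empty, so finite partitions are included.\<close>

definition countable_partition :: "'w measure \<Rightarrow> (nat \<Rightarrow> 'w set) \<Rightarrow> bool" where
  "countable_partition M A \<longleftrightarrow> range A \<subseteq> sets M \<and> disjoint_family A \<and> (\<Union>n. A n) = space M"

text \<open>
  The qualified name selects the modules of \<open>HOL-Algebra\<close>; the unqualified one could denote the
  type-class based locale underlying \<open>vector_space\<close>.
\<close>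

locale L0_module = prob_space M + Module.module "L0 M" E
  for M :: "'w measure" and E :: "(('w \<Rightarrow> real) set, 'e, 'm) module_scheme" +
  assumes partition_eqI:
    "\<And>A x y. \<lbrakk>countable_partition M A; x \<in> carrier E; y \<in> carrier E;
        \<And>n. L0_indicator M (A n) \<odot>\<^bsub>E\<^esub> x = L0_indicator M (A n) \<odot>\<^bsub>E\<^esub> y\<rbrakk> \<Longrightarrow> x = y"

definition L0_balanced ::
  "'w measure \<Rightarrow> (('w \<Rightarrow> real) set, 'e, 'm) module_scheme \<Rightarrow> 'e set \<Rightarrow> bool" where
  "L0_balanced M E B \<longleftrightarrow> B \<subseteq> carrier E \<and>
     (\<forall>\<eta>\<in>carrier (L0 M). L0_le M (L0_abs M \<eta>) \<one>\<^bsub>L0 M\<^esub> \<longrightarrow> (\<forall>x\<in>B. \<eta> \<odot>\<^bsub>E\<^esub> x \<in> B))"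

definition L0_convex ::
  "'w measure \<Rightarrow> (('w \<Rightarrow> real) set, 'e, 'm) module_scheme \<Rightarrow> 'e set \<Rightarrow> bool" where
  "L0_convex M E B \<longleftrightarrow> B \<subseteq> carrier E \<and>
     (\<forall>x\<in>B. \<forall>y\<in>B. \<forall>\<xi>\<in>L0_pos M. L0_le M \<xi> \<one>\<^bsub>L0 M\<^esub> \<longrightarrow>
        \<xi> \<odot>\<^bsub>E\<^esub> x \<oplus>\<^bsub>E\<^esub> (\<one>\<^bsub>L0 M\<^esub> \<ominus>\<^bsub>L0 M\<^esub> \<xi>) \<odot>\<^bsub>E\<^esub> y \<in> B)"

definition L0_absorbent ::
  "'w measure \<Rightarrow> (('w \<Rightarrow> real) set, 'e, 'm) module_scheme \<Rightarrow> 'e set \<Rightarrow> bool" where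
  "L0_absorbent M E B \<longleftrightarrow> B \<subseteq> carrier E \<and>
     (\<forall>x\<in>carrier E. \<exists>\<xi>\<in>L0_spos M. \<forall>\<eta>\<in>carrier (L0 M).
        L0_le M (L0_abs M \<eta>) \<xi> \<longrightarrow> \<eta> \<odot>\<^bsub>E\<^esub> x \<in> B)"

definition countable_concatenation ::
  "'w measure \<Rightarrow> (('w \<Rightarrow> real) set, 'e, 'm) module_scheme \<Rightarrow> 'e set \<Rightarrow> bool" where
  "countable_concatenation M E G \<longleftrightarrow>
     (\<forall>X A. range X \<subseteq> G \<and> countable_partition M A \<longrightarrow>
        (\<exists>x\<in>G. \<forall>n::nat. L0_indicator M (A n) \<odot>\<^bsub>E\<^esub> x = L0_indicator M (A n) \<odot>\<^bsub>E\<^esub> X n))"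

locale locally_L0_convex_module = L0_module M E
  for M :: "'w measure" and E :: "(('w \<Rightarrow> real) set, 'e, 'm) module_scheme" +
  fixes T :: "'e topology"
  assumes topspace_carrier: "topspace T = carrier E"
    and continuous_add:
      "continuous_map (prod_topology T T) T (\<lambda>(x, y). x \<oplus>\<^bsub>E\<^esub> y)"
    and continuous_smult:
      "continuous_map (prod_topology (L0_topology M) T) T (\<lambda>(\<xi>, x). \<xi> \<odot>\<^bsub>E\<^esub> x)"
    and local_base:
      "neighbourhood_base_at \<zero>\<^bsub>E\<^esub>
         (\<lambda>B. L0_balanced M E B \<and> L0_absorbent M E B \<and> L0_convex M E B) T"

definition L0_barrel ::
  "'w measure \<Rightarrow> (('w \<Rightarrow> real) set, 'e, 'm) module_scheme \<Rightarrow> 'e topology \<Rightarrow> 'e set \<Rightarrow> bool" where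
  "L0_barrel M E T B \<longleftrightarrow>
     L0_balanced M E B \<and> L0_absorbent M E B \<and> L0_convex M E B \<and> closedin T B"

locale L0_pre_barreled_module = locally_L0_convex_module M E T
  for M :: "'w measure" and E :: "(('w \<Rightarrow> real) set, 'e, 'm) module_scheme"
    and T :: "'e topology" +
  assumes barrel_neighbourhood:
    "\<And>B. \<lbrakk>L0_barrel M E T B; countable_concatenation M E B\<rbrakk> \<Longrightarrow> \<zero>\<^bsub>E\<^esub> \<in> T interior_of B"

definition L0_dual ::
  "'w measure \<Rightarrow> (('w \<Rightarrow> real) set, 'e, 'm) module_scheme \<Rightarrow> 'e topology
    \<Rightarrow> ('e \<Rightarrow> ('w \<Rightarrow> real) set) set" where
  "L0_dual M E T = {u \<in> carrier E \<rightarrow> carrier (L0 M).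
     (\<forall>x\<in>carrier E. \<forall>y\<in>carrier E. u (x \<oplus>\<^bsub>E\<^esub> y) = u x \<oplus>\<^bsub>L0 M\<^esub> u y) \<and>
     (\<forall>\<xi>\<in>carrier (L0 M). \<forall>x\<in>carrier E. u (\<xi> \<odot>\<^bsub>E\<^esub> x) = \<xi> \<otimes>\<^bsub>L0 M\<^esub> u x) \<and>
     continuous_map T (L0_topology M) u}"

section \<open>Extended-valued functions on a module\<close>

definition L0_dom ::
  "'w measure \<Rightarrow> (('w \<Rightarrow> real) set, 'e, 'm) module_scheme
    \<Rightarrow> ('e \<Rightarrow> ('w \<Rightarrow> ereal) set) \<Rightarrow> 'e set" where
  "L0_dom M E f =
     {x \<in> carrier E. L0_less M (L0_map M abs (f x)) (ae_class M (\<lambda>_. \<infinity>))}"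

definition L0_proper ::
  "'w measure \<Rightarrow> (('w \<Rightarrow> real) set, 'e, 'm) module_scheme
    \<Rightarrow> ('e \<Rightarrow> ('w \<Rightarrow> ereal) set) \<Rightarrow> bool" where
  "L0_proper M E f \<longleftrightarrow> L0_dom M E f \<noteq> {} \<and>
     (\<forall>x\<in>carrier E. L0_less M (ae_class M (\<lambda>_. -\<infinity>)) (f x))"

definition L0_convex_fun ::
  "'w measure \<Rightarrow> (('w \<Rightarrow> real) set, 'e, 'm) module_scheme
    \<Rightarrow> ('e \<Rightarrow> ('w \<Rightarrow> ereal) set) \<Rightarrow> bool" where
  "L0_convex_fun M E f \<longleftrightarrow>
     (\<forall>x\<in>carrier E. \<forall>y\<in>carrier E. \<forall>\<xi>\<in>L0_pos M. L0_le M \<xi> \<one>\<^bsub>L0 M\<^esub> \<longrightarrow>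
        L0_le M (f (\<xi> \<odot>\<^bsub>E\<^esub> x \<oplus>\<^bsub>E\<^esub> (\<one>\<^bsub>L0 M\<^esub> \<ominus>\<^bsub>L0 M\<^esub> \<xi>) \<odot>\<^bsub>E\<^esub> y))
          (L0_map2 M (+) (L0_map2 M (*) (L0_embed M \<xi>) (f x))
             (L0_map2 M (*) (L0_embed M (\<one>\<^bsub>L0 M\<^esub> \<ominus>\<^bsub>L0 M\<^esub> \<xi>)) (f y))))"

definition L0_lsc ::
  "'w measure \<Rightarrow> (('w \<Rightarrow> real) set, 'e, 'm) module_scheme \<Rightarrow> 'e topology
    \<Rightarrow> ('e \<Rightarrow> ('w \<Rightarrow> ereal) set) \<Rightarrow> bool" where
  "L0_lsc M E T f \<longleftrightarrow>
     (\<forall>r\<in>carrier (L0 M). closedin T {x \<in> carrier E. L0_le M (f x) (L0_embed M r)})"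

definition subdifferential ::
  "'w measure \<Rightarrow> (('w \<Rightarrow> real) set, 'e, 'm) module_scheme \<Rightarrow> 'e topology
    \<Rightarrow> ('e \<Rightarrow> ('w \<Rightarrow> ereal) set) \<Rightarrow> 'e \<Rightarrow> ('e \<Rightarrow> ('w \<Rightarrow> real) set) set" where
  "subdifferential M E T f x = {u \<in> L0_dual M E T.
     \<forall>y\<in>carrier E. L0_le M (L0_embed M (u (y \<ominus>\<^bsub>E\<^esub> x))) (L0_map2 M (-) (f y) (f x))}"

end

theory Submission
  imports Defs
begin

text \<open>
  Put \<open>g h = f (x + h) - f x\<close>. The set where \<open>g h \<le> 1\<close> and \<open>g (-h) \<le> 1\<close> is an $L^0$-barrel; it inherits
  the countable concatenation property from \<open>E\<close> because an $L^0$-convex function is local, so it is a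
  neighbourhood of the null element. Any homomorphism below \<open>g\<close> is bounded by 1 on it, hence
  continuous. Such a homomorphism exists by the Hahn--Banach argument: Zorn's lemma on partial
  homomorphisms below \<open>g\<close>, the value at a new element \<open>h\<close> being an essential supremum of lower bounds
  of the slopes in direction \<open>h\<close>.
\<close>

section \<open>Essential suprema\<close>

text \<open>The scalars form neither a field nor a totally ordered ring, and this shapes the
  extension argument. A new element \<open>h\<close> need not be independent of the submodule
  already treated: \<xi> h may lie in it although \<xi> is not zero. Homomorphisms are therefore
  built as relations, which may be generated freely; consistency comes afterwards from the bound by
  \<open>g\<close>. A scalar may be positive on one part of the space and negative on another, so
  the inequalities for the two signs are glued by locality. Finally, \<open>g\<close> may be
  infinite on part of the space, where a slope is no real number; hence the supremum ranges over
  real-valued lower bounds, patched where needed. The interior enters through scalars: in each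
  direction \<open>h\<close>, some \<epsilon> > 0 makes \<open>g\<close> finite at \<epsilon> h and
  at -\<epsilon> h, which bounds the slopes and absorbs \<open>h\<close> into the barrel. Lower
  semicontinuity makes the barrel closed.\<close>

lemma (in finite_measure) essential_supremum:
  fixes S :: "('a \<Rightarrow> real) set"
  assumes ne: "S \<noteq> {}" and meas: "S \<subseteq> borel_measurable M"
    and bound: "\<And>s. s \<in> S \<Longrightarrow> AE w in M. s w \<le> q w"
  obtains p a where "range p \<subseteq> S" "a \<in> borel_measurable M"
    "AE w in M. \<forall>c. a w \<le> c \<longleftrightarrow> (\<forall>n::nat. p n w \<le> c)"
    "\<And>s. s \<in> S \<Longrightarrow> AE w in M. s w \<le> a w"
proof -
  \<comment> \<open>The bounded increasing transform arctan, made positive by adding \<pi>, gives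
    suprema of finite integral. Maximizing over sequences in \<open>S\<close> rather than over
    single members takes the place of closure under finite maxima.\<close>
  define J :: "(nat \<Rightarrow> 'a \<Rightarrow> real) \<Rightarrow> 'a \<Rightarrow> ennreal"
    where "J X w = (SUP n. ennreal (pi + arctan (X n w)))" for X w
  define I where "I X = (\<integral>\<^sup>+ w. J X w \<partial>M)" for X
  define V where "V = Sup (I ` {X. range X \<subseteq> S})"
  have J_measurable: "J X \<in> borel_measurable M" if "range X \<subseteq> S" for X
  proof -
    have [measurable]: "X n \<in> borel_measurable M" for n using that meas by blast
    have [measurable]: "(\<lambda>w. arctan (X n w)) \<in> borel_measurable M" for n
      by (rule borel_measurable_continuous_on[OF _ \<open>X n \<in> _\<close>]) (auto intro!: continuous_intros)
    show ?thesis unfolding J_def[abs_def] by measurable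
  qed
  have J_bound: "J X w \<le> ennreal (2 * pi)" for X w
    unfolding J_def using arctan_ubound pi_gt_zero
    by (intro SUP_least ennreal_leI) (smt (verit) field_sum_of_halves)
  obtain s0 where "s0 \<in> S" using ne by blast
  then have "I ` {X. range X \<subseteq> S} \<noteq> {}" by (auto intro!: exI[of _ "\<lambda>_. s0"])
  from ennreal_Sup_countable_SUP[OF this] obtain Z :: "nat \<Rightarrow> ennreal"
    where Z: "range Z \<subseteq> I ` {X. range X \<subseteq> S}" "V = (SUP k. Z k)"
    unfolding V_def by blast
  then have "\<forall>k. \<exists>X. range X \<subseteq> S \<and> Z k = I X" by blast
  then obtain X where X: "\<And>k. range (X k) \<subseteq> S" "\<And>k. Z k = I (X k)" by metis
  \<comment> \<open>Listing all entries of the maximizing sequences \<open>X k\<close> in one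
    sequence gives a supremum above every \<open>J (X k)\<close>, so the value \<open>V\<close> is
    attained.\<close>
  define p where "p n = X (fst (prod_decode n)) (snd (prod_decode n))" for n
  have p: "range p \<subseteq> S" using X(1) by (auto simp: p_def)
  have "I (X k) \<le> I p" for k
    unfolding I_def J_def
  proof (intro nn_integral_mono SUP_least)
    fix w j
    show "ennreal (pi + arctan (X k j w)) \<le> (SUP n. ennreal (pi + arctan (p n w)))"
      by (rule SUP_upper2[of "prod_encode (k, j)"]) (auto simp: p_def)
  qed
  then have V_le: "V \<le> I p" using Z X by (auto intro: SUP_least)
  have I_fin: "I p \<noteq> \<infinity>"
  proof -
    have "I p \<le> (\<integral>\<^sup>+ w. ennreal (2 * pi) \<partial>M)"
      unfolding I_def by (intro nn_integral_mono J_bound)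
    also have "\<dots> < \<infinity>" by (simp add: emeasure_eq_measure ennreal_mult_less_top)
    finally show ?thesis by simp
  qed
  \<comment> \<open>The supremum is formed in \<open>ereal\<close>, where it always exists and is
    measurable; the bound \<open>q\<close> makes it finite almost everywhere, so the conversion
    loses nothing there.\<close>
  define a where "a w = real_of_ereal (SUP n. ereal (p n w))" for w
  have [measurable]: "p n \<in> borel_measurable M" for n using p meas by blast
  have a_meas: "a \<in> borel_measurable M" unfolding a_def[abs_def] by measurable
  have "AE w in M. \<forall>n. p n w \<le> q w"
    using p bound by (subst AE_all_countable) blast
  then have lub: "AE w in M. \<forall>c. a w \<le> c \<longleftrightarrow> (\<forall>n. p n w \<le> c)"
  proof eventually_elim
    case (elim w)
    have "(SUP n. ereal (p n w)) \<le> ereal (q w)" using elim by (auto intro: SUP_least)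
    moreover have "ereal (p 0 w) \<le> (SUP n. ereal (p n w))" by (rule SUP_upper) simp
    ultimately have "ereal (a w) = (SUP n. ereal (p n w))"
      unfolding a_def by (cases "SUP n. ereal (p n w)") auto
    then have "a w \<le> c \<longleftrightarrow> (SUP n. ereal (p n w)) \<le> ereal c" for c
      by (metis ereal_less_eq(3))
    then show ?case by (simp add: SUP_le_iff)
  qed
  have "AE w in M. s w \<le> a w" if s: "s \<in> S" for s
  proof -
    \<comment> \<open>Prepending \<open>s\<close> cannot raise the integral beyond \<open>V\<close>,
      while \<open>J Y\<close> lies above \<open>J p\<close>. Equal finite integrals force equality
      almost everywhere, so \<open>s\<close> adds nothing to the supremum.\<close>
    define Y where "Y n = (case n of 0 \<Rightarrow> s | Suc m \<Rightarrow> p m)" for n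
    have Y: "range Y \<subseteq> S" using s p by (force simp: Y_def split: nat.split)
    then have "I Y \<le> I p" using V_le by (auto simp: V_def intro: order_trans[rotated] SUP_upper)
    moreover have "J p w \<le> J Y w" for w
      unfolding J_def
    proof (rule SUP_least)
      fix n
      show "ennreal (pi + arctan (p n w)) \<le> (SUP n. ennreal (pi + arctan (Y n w)))"
        by (rule SUP_upper2[of "Suc n"]) (auto simp: Y_def)
    qed
    ultimately have "AE w in M. J Y w \<le> J p w"
      using nn_integral_less[OF J_measurable[OF p] J_measurable[OF Y]] I_fin
      unfolding I_def by (auto simp: not_less[symmetric])
    with lub show ?thesis
    proof eventually_elim
      case (elim w)
      have "ennreal (pi + arctan (s w)) \<le> J Y w"
        unfolding J_def by (rule SUP_upper2[of 0]) (auto simp: Y_def)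
      also have "\<dots> \<le> J p w" by (fact elim)
      also have "\<dots> \<le> ennreal (pi + arctan (a w))"
        unfolding J_def using elim(1) by (intro SUP_least ennreal_leI) (auto simp: arctan_le_iff)
      finally have "pi + arctan (s w) \<le> pi + arctan (a w)"
        using arctan_lbound[of "a w"] pi_gt_zero
        by (subst (asm) ennreal_le_iff) (linarith, assumption)
      then show ?case by (simp add: arctan_le_iff)
    qed
  qed
  with p a_meas lub that show thesis by blast
qed

section \<open>Multiplication by random variables\<close>

lemma ae_class_carrier [simp]: "\<phi> \<in> borel_measurable M \<Longrightarrow> ae_class M \<phi> \<in> carrier (L0 M)"
  by (simp add: L0_def L0_space_def)

lemma L0_carrierE:
  assumes "\<xi> \<in> carrier (L0 M)"
  obtains \<phi> where "\<phi> \<in> borel_measurable M" "\<xi> = ae_class M \<phi>"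
  using assms by (auto simp: L0_def L0_space_def)

lemma L0_ring_ops:
  assumes "\<phi> \<in> borel_measurable M" "\<psi> \<in> borel_measurable M"
  shows "ae_class M \<phi> \<oplus>\<^bsub>L0 M\<^esub> ae_class M \<psi> = ae_class M (\<lambda>w. \<phi> w + \<psi> w)"
    and "ae_class M \<phi> \<otimes>\<^bsub>L0 M\<^esub> ae_class M \<psi> = ae_class M (\<lambda>w. \<phi> w * \<psi> w)"
  using assms by (simp_all add: L0_def L0_map2_ae_class)

lemma L0_one: "\<one>\<^bsub>L0 M\<^esub> = ae_class M (\<lambda>_. 1)"
  and L0_zero: "\<zero>\<^bsub>L0 M\<^esub> = ae_class M (\<lambda>_. 0)"
  by (simp_all add: L0_def)

text \<open>Redefining the representative as 1 on the null set where it fails to be positive makes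
  it positive everywhere, so later quotients by it need no exceptional set.\<close>

lemma L0_sposE:
  assumes "\<epsilon> \<in> L0_spos M"
  obtains e where "e \<in> borel_measurable M" "\<And>w. 0 < e w" "\<epsilon> = ae_class M e"
proof -
  from assms obtain e where e: "e \<in> borel_measurable M" "\<epsilon> = ae_class M e"
    by (auto simp: L0_spos_def elim: L0_carrierE)
  then have pos: "AE w in M. 0 < e w"
    using assms by (simp add: L0_spos_def L0_zero L0_rel_ae_class)
  let ?e = "\<lambda>w. if 0 < e w then e w else 1"
  have [measurable]: "e \<in> borel_measurable M" by (fact e)
  have "\<epsilon> = ae_class M ?e"
    unfolding e(2) by (subst ae_class_eq_iff) (use pos in \<open>auto elim: eventually_mono\<close>)
  then show thesis by (intro that[of ?e]) auto
qed

lemma L0_sposI: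
  "e \<in> borel_measurable M \<Longrightarrow> AE w in M. 0 < e w \<Longrightarrow> ae_class M e \<in> L0_spos M"
  by (simp add: L0_spos_def L0_zero L0_rel_ae_class)

context L0_module
begin

text \<open>Scalars act through measurable representatives, so that identities between scalars
  reduce to pointwise identities of real functions.\<close>

definition sc :: "('w \<Rightarrow> real) \<Rightarrow> 'e \<Rightarrow> 'e"
  where "sc \<phi> x = ae_class M \<phi> \<odot>\<^bsub>E\<^esub> x"

lemma sc_closed [simp]: "\<phi> \<in> borel_measurable M \<Longrightarrow> x \<in> carrier E \<Longrightarrow> sc \<phi> x \<in> carrier E"
  by (simp add: sc_def)

lemma sc_sc:
  "\<phi> \<in> borel_measurable M \<Longrightarrow> \<psi> \<in> borel_measurable M \<Longrightarrow> x \<in> carrier E \<Longrightarrow>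
    sc \<phi> (sc \<psi> x) = sc (\<lambda>w. \<phi> w * \<psi> w) x"
  by (simp add: sc_def smult_assoc1[symmetric] L0_ring_ops)

lemma sc_add_left:
  "\<phi> \<in> borel_measurable M \<Longrightarrow> \<psi> \<in> borel_measurable M \<Longrightarrow> x \<in> carrier E \<Longrightarrow>
    sc \<phi> x \<oplus>\<^bsub>E\<^esub> sc \<psi> x = sc (\<lambda>w. \<phi> w + \<psi> w) x"
  by (simp add: sc_def smult_l_distr[symmetric] L0_ring_ops)

lemma sc_add_right:
  "\<phi> \<in> borel_measurable M \<Longrightarrow> x \<in> carrier E \<Longrightarrow> y \<in> carrier E \<Longrightarrow>
    sc \<phi> (x \<oplus>\<^bsub>E\<^esub> y) = sc \<phi> x \<oplus>\<^bsub>E\<^esub> sc \<phi> y"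
  by (simp add: sc_def smult_r_distr)

lemma sc_one [simp]: "x \<in> carrier E \<Longrightarrow> sc (\<lambda>_. 1) x = x"
  by (simp add: sc_def L0_one[symmetric])

lemma sc_zero [simp]: "x \<in> carrier E \<Longrightarrow> sc (\<lambda>_. 0) x = \<zero>\<^bsub>E\<^esub>"
  by (simp add: sc_def L0_zero[symmetric])

lemma sc_zero_right [simp]: "\<phi> \<in> borel_measurable M \<Longrightarrow> sc \<phi> \<zero>\<^bsub>E\<^esub> = \<zero>\<^bsub>E\<^esub>"
  by (simp add: sc_def)

lemma sc_cong_AE:
  "\<phi> \<in> borel_measurable M \<Longrightarrow> \<psi> \<in> borel_measurable M \<Longrightarrow> AE w in M. \<phi> w = \<psi> w \<Longrightarrow> sc \<phi> x = sc \<psi> x"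
  unfolding sc_def by (metis ae_class_eq_iff)

lemma add_swap:
  assumes "x \<in> carrier E" "y \<in> carrier E" "z \<in> carrier E" "t \<in> carrier E"
  shows "(x \<oplus>\<^bsub>E\<^esub> y) \<oplus>\<^bsub>E\<^esub> (z \<oplus>\<^bsub>E\<^esub> t) = (x \<oplus>\<^bsub>E\<^esub> z) \<oplus>\<^bsub>E\<^esub> (y \<oplus>\<^bsub>E\<^esub> t)"
  using assms by (simp add: M.add.m_ac)

lemma sc_combination:
  assumes "\<phi> \<in> borel_measurable M" "\<psi> \<in> borel_measurable M" "x \<in> carrier E" "y \<in> carrier E"
    and [measurable]: "\<rho> \<in> borel_measurable M"
  shows "sc \<phi> (sc \<rho> x) \<oplus>\<^bsub>E\<^esub> sc \<psi> (sc \<rho> y) = sc \<rho> (sc \<phi> x \<oplus>\<^bsub>E\<^esub> sc \<psi> y)"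
  using assms by (simp add: sc_add_right sc_sc mult.commute)

end

section \<open>Convex functions and the Hahn--Banach theorem\<close>

text \<open>Models \<open>h \<mapsto> f (x + h) - f x\<close> for an interior point \<open>x\<close> of the domain of \<open>f\<close>.\<close>

locale L0_convex_germ = L0_module M E
  for M :: "'w measure" and E :: "(('w \<Rightarrow> real) set, 'e, 'm) module_scheme" +
  fixes g :: "'e \<Rightarrow> 'w \<Rightarrow> ereal"
  assumes g_measurable [measurable]: "x \<in> carrier E \<Longrightarrow> g x \<in> borel_measurable M"
    and g_not_MInf: "x \<in> carrier E \<Longrightarrow> AE w in M. g x w \<noteq> -\<infinity>"
    and g_zero: "AE w in M. g \<zero>\<^bsub>E\<^esub> w = 0"
    and g_convex: "\<lbrakk>x \<in> carrier E; y \<in> carrier E; \<phi> \<in> borel_measurable M;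
        AE w in M. 0 \<le> \<phi> w \<and> \<phi> w \<le> 1\<rbrakk> \<Longrightarrow>
      AE w in M. g (sc \<phi> x \<oplus>\<^bsub>E\<^esub> sc (\<lambda>w. 1 - \<phi> w) y) w
        \<le> ereal (\<phi> w) * g x w + ereal (1 - \<phi> w) * g y w"
    and g_absorb: "x \<in> carrier E \<Longrightarrow> \<exists>\<epsilon> \<in> borel_measurable M. (\<forall>w. 0 < \<epsilon> w) \<and>
      (AE w in M. g (sc \<epsilon> x) w < \<infinity>) \<and> (AE w in M. g (sc (\<lambda>w. - \<epsilon> w) x) w < \<infinity>)"
begin

section \<open>Locality of convex functions\<close>

lemma g_local_le:
  assumes xy: "x \<in> carrier E" "y \<in> carrier E" and A [measurable]: "A \<in> sets M"
    and eq: "sc (indicator A) x = sc (indicator A) y"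
  shows "AE w in M. w \<in> A \<longrightarrow> g x w \<le> g y w"
proof -
  \<comment> \<open>Since \<open>x\<close> and \<open>y\<close> agree on \<open>A\<close>,
    \<open>x\<close> is the combination of \<open>y\<close> and itself with weight
    \<open>indicator A\<close>. On \<open>A\<close> the convexity bound reduces to the value at
    \<open>y\<close>, because 0 times an infinite value is 0.\<close>
  have "x = sc (indicator A) y \<oplus>\<^bsub>E\<^esub> sc (\<lambda>w. 1 - indicator A w) x"
    using xy by (simp add: eq[symmetric] sc_add_left)
  moreover have "AE w in M. g (sc (indicator A) y \<oplus>\<^bsub>E\<^esub> sc (\<lambda>w. 1 - indicator A w) x) w
      \<le> ereal (indicator A w) * g y w + ereal (1 - indicator A w) * g x w"
    by (rule g_convex) (use xy in \<open>auto simp: indicator_def\<close>)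
  ultimately have "AE w in M. g x w
      \<le> ereal (indicator A w) * g y w + ereal (1 - indicator A w) * g x w"
    by simp
  then show ?thesis
    by eventually_elim (auto simp: zero_ereal_def[symmetric] one_ereal_def[symmetric])
qed

lemma g_local:
  assumes "x \<in> carrier E" "y \<in> carrier E" "A \<in> sets M"
    and "sc (indicator A) x = sc (indicator A) y"
  shows "AE w in M. w \<in> A \<longrightarrow> g x w = g y w"
  using g_local_le[OF assms] g_local_le[OF assms(2,1,3) assms(4)[symmetric]]
  by eventually_elim (auto intro: antisym)

text \<open>Multiplying by the indicator of the set where the coefficients agree erases their
  difference, so locality applies. It serves to treat separately the regions where a scalar is
  positive, negative or zero.\<close>

lemma g_local_sc:
  assumes yh: "y \<in> carrier E" "h \<in> carrier E"
    and [measurable]: "\<phi> \<in> borel_measurable M" "\<psi> \<in> borel_measurable M"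
  shows "AE w in M. \<phi> w = \<psi> w \<longrightarrow> g (y \<oplus>\<^bsub>E\<^esub> sc \<phi> h) w = g (y \<oplus>\<^bsub>E\<^esub> sc \<psi> h) w"
proof -
  define A where "A = {w \<in> space M. \<phi> w = \<psi> w}"
  have A [measurable]: "A \<in> sets M" unfolding A_def by measurable
  have "sc (\<lambda>w. indicator A w * \<phi> w) h = sc (\<lambda>w. indicator A w * \<psi> w) h"
    by (rule sc_cong_AE) (auto simp: A_def indicator_def)
  then have "sc (indicator A) (y \<oplus>\<^bsub>E\<^esub> sc \<phi> h) = sc (indicator A) (y \<oplus>\<^bsub>E\<^esub> sc \<psi> h)"
    using yh by (simp add: sc_add_right sc_sc)
  then have "AE w in M. w \<in> A \<longrightarrow> g (y \<oplus>\<^bsub>E\<^esub> sc \<phi> h) w = g (y \<oplus>\<^bsub>E\<^esub> sc \<psi> h) w"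
    using yh by (intro g_local A) auto
  then show ?thesis by (rule AE_mp) (auto simp: A_def)
qed

text \<open>
  Graphs of module homomorphisms below \<open>g\<close>, defined on submodules. That such a relation is
  single-valued a.e. follows from the bound by \<open>g\<close>, see \<open>minorant_graph_unique\<close>.
\<close>

definition minorant_graph :: "('e \<times> ('w \<Rightarrow> real)) set \<Rightarrow> bool" where
  "minorant_graph G \<longleftrightarrow> G \<subseteq> carrier E \<times> borel_measurable M \<and> (\<zero>\<^bsub>E\<^esub>, \<lambda>_. 0) \<in> G \<and>
     (\<forall>x r y s. (x, r) \<in> G \<longrightarrow> (y, s) \<in> G \<longrightarrow> (x \<oplus>\<^bsub>E\<^esub> y, \<lambda>w. r w + s w) \<in> G) \<and>
     (\<forall>x r \<phi>. (x, r) \<in> G \<longrightarrow> \<phi> \<in> borel_measurable M \<longrightarrow> (sc \<phi> x, \<lambda>w. \<phi> w * r w) \<in> G) \<and>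
     (\<forall>x r. (x, r) \<in> G \<longrightarrow> (AE w in M. ereal (r w) \<le> g x w))"

lemma minorant_graphD:
  assumes "minorant_graph G"
  shows "(x, r) \<in> G \<Longrightarrow> x \<in> carrier E" "(x, r) \<in> G \<Longrightarrow> r \<in> borel_measurable M"
    "(\<zero>\<^bsub>E\<^esub>, \<lambda>_. 0) \<in> G"
    "(x, r) \<in> G \<Longrightarrow> (y, s) \<in> G \<Longrightarrow> (x \<oplus>\<^bsub>E\<^esub> y, \<lambda>w. r w + s w) \<in> G"
    "(x, r) \<in> G \<Longrightarrow> \<phi> \<in> borel_measurable M \<Longrightarrow> (sc \<phi> x, \<lambda>w. \<phi> w * r w) \<in> G"
    "(x, r) \<in> G \<Longrightarrow> AE w in M. ereal (r w) \<le> g x w"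
  using assms unfolding minorant_graph_def by blast+

text \<open>Subtracting the two pairs gives a pair over the null element, where \<open>g\<close> is
  0. Scaling by 1 and by -1 bounds the difference from both sides.\<close>

lemma minorant_graph_unique:
  assumes G: "minorant_graph G" and "(x, r) \<in> G" "(x, s) \<in> G"
  shows "AE w in M. r w = s w"
proof -
  have x: "x \<in> carrier E" and [measurable]: "r \<in> borel_measurable M" "s \<in> borel_measurable M"
    using assms by (auto dest: minorant_graphD)
  have nonpos: "AE w in M. \<phi> w * (r w - s w) \<le> 0" if [measurable]: "\<phi> \<in> borel_measurable M" for \<phi>
  proof -
    have "(sc \<phi> x \<oplus>\<^bsub>E\<^esub> sc (\<lambda>w. - \<phi> w) x, \<lambda>w. \<phi> w * r w + - \<phi> w * s w) \<in> G"
      using assms by (intro minorant_graphD(4,5)[OF G]) auto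
    then have "AE w in M. ereal (\<phi> w * r w + - \<phi> w * s w) \<le> g (sc \<phi> x \<oplus>\<^bsub>E\<^esub> sc (\<lambda>w. - \<phi> w) x) w"
      by (rule minorant_graphD(6)[OF G])
    moreover have "sc \<phi> x \<oplus>\<^bsub>E\<^esub> sc (\<lambda>w. - \<phi> w) x = \<zero>\<^bsub>E\<^esub>" using x by (simp add: sc_add_left)
    ultimately have "AE w in M. ereal (\<phi> w * r w + - \<phi> w * s w) \<le> g \<zero>\<^bsub>E\<^esub> w" by simp
    with g_zero show ?thesis by eventually_elim (simp add: algebra_simps)
  qed
  have "AE w in M. 1 * (r w - s w) \<le> 0" "AE w in M. -1 * (r w - s w) \<le> 0"
    by (rule nonpos, simp)+
  then show ?thesis by eventually_elim simp
qed

section \<open>Slopes and extension by one new direction\<close>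

lemma convex_slope_le:
  fixes r r' \<xi> \<xi>' :: real
  assumes "0 < \<xi>" "0 < \<xi>'" "A \<noteq> \<infinity>" "A \<noteq> -\<infinity>" "B \<noteq> -\<infinity>"
    and le: "ereal (\<xi> / (\<xi> + \<xi>') * r' + (1 - \<xi> / (\<xi> + \<xi>')) * r)
      \<le> ereal (\<xi> / (\<xi> + \<xi>')) * A + ereal (1 - \<xi> / (\<xi> + \<xi>')) * B"
  shows "ereal (r + \<xi> * ((r' - real_of_ereal A) / \<xi>')) \<le> B"
proof (cases A; cases B)
  fix \<alpha> \<beta> assume eq: "A = ereal \<alpha>" "B = ereal \<beta>"
  have l: "1 - \<xi> / (\<xi> + \<xi>') = \<xi>' / (\<xi> + \<xi>')"
    using assms(1,2) by (simp add: field_simps)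
  \<comment> \<open>Without the common denominator this says that the backward slope (r' - \<alpha>)
    / \<xi>' is at most the forward slope (\<beta> - r) / \<xi>. The conclusion of the lemma is kept
    in multiplied form because \<open>B\<close> may be infinite.\<close>
  have "(\<xi> * r' + \<xi>' * r) / (\<xi> + \<xi>') \<le> (\<xi> * \<alpha> + \<xi>' * \<beta>) / (\<xi> + \<xi>')"
    using le by (simp add: eq l add_divide_distrib)
  then have "\<xi> * r' + \<xi>' * r \<le> \<xi> * \<alpha> + \<xi>' * \<beta>"
    using assms(1,2) by (simp add: divide_le_cancel)
  then have "\<xi> * (r' - \<alpha>) / \<xi>' \<le> \<beta> - r"
    using assms(2) by (subst pos_divide_le_eq) (auto simp: algebra_simps)
  then show ?thesis by (simp add: eq)
qed (use assms in auto)

lemma minorant_graph_slope_le: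
  assumes G: "minorant_graph G" and h: "h \<in> carrier E"
    and yr: "(y, r) \<in> G" and yr': "(y', r') \<in> G"
    and [measurable]: "\<xi> \<in> borel_measurable M" "\<xi>' \<in> borel_measurable M"
    and pos: "\<And>w. 0 < \<xi> w" "\<And>w. 0 < \<xi>' w"
  shows "AE w in M. g (y' \<oplus>\<^bsub>E\<^esub> sc (\<lambda>w. - \<xi>' w) h) w \<noteq> \<infinity> \<longrightarrow>
    ereal (r w + \<xi> w * ((r' w - real_of_ereal (g (y' \<oplus>\<^bsub>E\<^esub> sc (\<lambda>w. - \<xi>' w) h) w)) / \<xi>' w))
      \<le> g (y \<oplus>\<^bsub>E\<^esub> sc \<xi> h) w"
proof -
  \<comment> \<open>With this weight the components along \<open>h\<close> of y' - \<xi>' h and y +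
    \<xi> h cancel, so the convex combination involves only \<open>y'\<close> and \<open>y\<close>,
    and \<open>G\<close> bounds \<open>g\<close> there from below.\<close>
  define l where "l w = \<xi> w / (\<xi> w + \<xi>' w)" for w
  have [measurable]: "l \<in> borel_measurable M" unfolding l_def[abs_def] by measurable
  have y: "y \<in> carrier E" "y' \<in> carrier E" using minorant_graphD(1)[OF G] yr yr' by auto
  have l: "0 \<le> l w \<and> l w \<le> 1" "l w * - \<xi>' w + (1 - l w) * \<xi> w = 0" for w
    using pos[of w] add_pos_pos[OF pos(1,2), of w w] by (auto simp: l_def field_simps)
  let ?u = "y' \<oplus>\<^bsub>E\<^esub> sc (\<lambda>w. - \<xi>' w) h" and ?v = "y \<oplus>\<^bsub>E\<^esub> sc \<xi> h"
  have uv: "?u \<in> carrier E" "?v \<in> carrier E" using y h by auto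
  have "sc l ?u \<oplus>\<^bsub>E\<^esub> sc (\<lambda>w. 1 - l w) ?v
      = (sc l y' \<oplus>\<^bsub>E\<^esub> sc (\<lambda>w. 1 - l w) y)
        \<oplus>\<^bsub>E\<^esub> (sc (\<lambda>w. l w * - \<xi>' w) h \<oplus>\<^bsub>E\<^esub> sc (\<lambda>w. (1 - l w) * \<xi> w) h)"
    using y h by (simp add: sc_add_right sc_sc add_swap)
  also have "sc (\<lambda>w. l w * - \<xi>' w) h \<oplus>\<^bsub>E\<^esub> sc (\<lambda>w. (1 - l w) * \<xi> w) h = \<zero>\<^bsub>E\<^esub>"
    using h by (subst sc_add_left) (simp_all only: l sc_zero, measurable)
  finally have eq: "sc l ?u \<oplus>\<^bsub>E\<^esub> sc (\<lambda>w. 1 - l w) ?v = sc l y' \<oplus>\<^bsub>E\<^esub> sc (\<lambda>w. 1 - l w) y"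
    using y by simp
  have "(sc l y' \<oplus>\<^bsub>E\<^esub> sc (\<lambda>w. 1 - l w) y, \<lambda>w. l w * r' w + (1 - l w) * r w) \<in> G"
    by (intro minorant_graphD(4,5)[OF G] yr yr') measurable
  from minorant_graphD(6)[OF G this]
  have "AE w in M. ereal (l w * r' w + (1 - l w) * r w) \<le> g (sc l ?u \<oplus>\<^bsub>E\<^esub> sc (\<lambda>w. 1 - l w) ?v) w"
    by (simp only: eq)
  moreover have "AE w in M. g (sc l ?u \<oplus>\<^bsub>E\<^esub> sc (\<lambda>w. 1 - l w) ?v) w
      \<le> ereal (l w) * g ?u w + ereal (1 - l w) * g ?v w"
    by (rule g_convex) (use uv l in auto)
  ultimately show ?thesis
    using g_not_MInf[OF uv(1)] g_not_MInf[OF uv(2)]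
  proof (eventually_elim, intro impI)
    fix w
    assume "ereal (l w * r' w + (1 - l w) * r w) \<le> g (sc l ?u \<oplus>\<^bsub>E\<^esub> sc (\<lambda>w. 1 - l w) ?v) w"
      "g (sc l ?u \<oplus>\<^bsub>E\<^esub> sc (\<lambda>w. 1 - l w) ?v) w
        \<le> ereal (l w) * g ?u w + ereal (1 - l w) * g ?v w"
      and inf: "g ?u w \<noteq> -\<infinity>" "g ?v w \<noteq> -\<infinity>" "g ?u w \<noteq> \<infinity>"
    then have "ereal (l w * r' w + (1 - l w) * r w)
        \<le> ereal (l w) * g ?u w + ereal (1 - l w) * g ?v w"
      by (rule_tac order_trans)
    then show "ereal (r w + \<xi> w * ((r' w - real_of_ereal (g ?u w)) / \<xi>' w)) \<le> g ?v w"
      unfolding l_def using inf by (intro convex_slope_le pos)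
  qed
qed

text \<open>The largest possible value is taken: \<open>a\<close> is the essential supremum of the
  real functions below all forward slopes. The forward inequalities pass to the supremum; the
  backward ones hold because the backward slopes, suitably patched, are among these
  functions.\<close>

lemma minorant_graph_value:
  assumes G: "minorant_graph G" and h: "h \<in> carrier E"
  obtains a where "a \<in> borel_measurable M"
    "\<And>y r \<xi>. (y, r) \<in> G \<Longrightarrow> \<xi> \<in> borel_measurable M \<Longrightarrow>
      AE w in M. ereal (r w + \<xi> w * a w) \<le> g (y \<oplus>\<^bsub>E\<^esub> sc \<xi> h) w"
proof -
  define P where "P = {p \<in> borel_measurable M. \<forall>y r \<xi>. (y, r) \<in> G \<longrightarrow> \<xi> \<in> borel_measurable M \<longrightarrow>
    (\<forall>w. 0 < \<xi> w) \<longrightarrow> (AE w in M. ereal (r w + \<xi> w * p w) \<le> g (y \<oplus>\<^bsub>E\<^esub> sc \<xi> h) w)}"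
  note z = minorant_graphD(3)[OF G]
  obtain \<epsilon> where \<epsilon> [measurable]: "\<epsilon> \<in> borel_measurable M" and \<epsilon>_pos: "\<And>w. 0 < \<epsilon> w"
    and \<epsilon>_fin: "AE w in M. g (sc \<epsilon> h) w < \<infinity>" "AE w in M. g (sc (\<lambda>w. - \<epsilon> w) h) w < \<infinity>"
    using g_absorb[OF h] by blast
  \<comment> \<open>The backward slope from the null element with step \<epsilon>. It is a genuine
    slope almost everywhere, hence a member of \<open>P\<close>, and later the default where other
    backward slopes are infinite.\<close>
  define p0 where "p0 w = (0 - real_of_ereal (g (\<zero>\<^bsub>E\<^esub> \<oplus>\<^bsub>E\<^esub> sc (\<lambda>w. - \<epsilon> w) h) w)) / \<epsilon> w" for w
  have p0: "p0 \<in> P"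
    unfolding P_def
  proof (intro CollectI conjI allI impI)
    have [measurable]: "g (\<zero>\<^bsub>E\<^esub> \<oplus>\<^bsub>E\<^esub> sc (\<lambda>w. - \<epsilon> w) h) \<in> borel_measurable M"
      using h by (intro g_measurable) auto
    show "p0 \<in> borel_measurable M" unfolding p0_def[abs_def] by measurable
    fix y r and \<xi> :: "'w \<Rightarrow> real" assume *: "(y, r) \<in> G" "\<xi> \<in> borel_measurable M" "\<forall>w. 0 < \<xi> w"
    from minorant_graph_slope_le[OF G h *(1) z *(2) \<epsilon>] *(3) \<epsilon>_pos
    have "AE w in M. g (\<zero>\<^bsub>E\<^esub> \<oplus>\<^bsub>E\<^esub> sc (\<lambda>w. - \<epsilon> w) h) w \<noteq> \<infinity> \<longrightarrow>
        ereal (r w + \<xi> w * p0 w) \<le> g (y \<oplus>\<^bsub>E\<^esub> sc \<xi> h) w" by (simp add: p0_def)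
    with \<epsilon>_fin(2) show "AE w in M. ereal (r w + \<xi> w * p0 w) \<le> g (y \<oplus>\<^bsub>E\<^esub> sc \<xi> h) w"
      by eventually_elim (use h in auto)
  qed
  \<comment> \<open>Testing the defining inequality at the null element with step \<epsilon> bounds
    every member by one finite forward slope, as the essential supremum requires.\<close>
  have bound: "AE w in M. p w \<le> real_of_ereal (g (sc \<epsilon> h) w) / \<epsilon> w" if "p \<in> P" for p
  proof -
    have "AE w in M. ereal (0 + \<epsilon> w * p w) \<le> g (\<zero>\<^bsub>E\<^esub> \<oplus>\<^bsub>E\<^esub> sc \<epsilon> h) w"
      using that z \<epsilon> \<epsilon>_pos unfolding P_def by blast
    with \<epsilon>_fin(1) show ?thesis
    proof eventually_elim
      case (elim w)
      then have "ereal (\<epsilon> w * p w) \<le> g (sc \<epsilon> h) w" "g (sc \<epsilon> h) w < \<infinity>" using h by auto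
      then show ?case using \<epsilon>_pos[of w] by (cases "g (sc \<epsilon> h) w") (auto simp: field_simps)
    qed
  qed
  have "P \<noteq> {}" "P \<subseteq> borel_measurable M" using p0 by (blast, auto simp: P_def)
  from essential_supremum[OF this bound] obtain p a where p: "range p \<subseteq> P"
    and a [measurable]: "a \<in> borel_measurable M"
    and lub: "AE w in M. \<forall>c. a w \<le> c \<longleftrightarrow> (\<forall>n::nat. p n w \<le> c)"
    and ub: "\<And>s. s \<in> P \<Longrightarrow> AE w in M. s w \<le> a w"
    by blast
  have pos: "AE w in M. ereal (r w + \<xi> w * a w) \<le> g (y \<oplus>\<^bsub>E\<^esub> sc \<xi> h) w"
    if yr: "(y, r) \<in> G" and \<xi>: "\<xi> \<in> borel_measurable M" "\<And>w. 0 < \<xi> w" for y r \<xi>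
  proof -
    \<comment> \<open>The supremum is reached along a countable family, so the exceptional null sets
      can be united before passing to \<open>a\<close> pointwise.\<close>
    have "AE w in M. \<forall>n. ereal (r w + \<xi> w * p n w) \<le> g (y \<oplus>\<^bsub>E\<^esub> sc \<xi> h) w"
      using p yr \<xi> unfolding P_def by (subst AE_all_countable) blast
    with lub show ?thesis
    proof eventually_elim
      case (elim w)
      show ?case
      proof (cases "g (y \<oplus>\<^bsub>E\<^esub> sc \<xi> h) w")
        case (real c)
        then have "\<forall>n. p n w \<le> (c - r w) / \<xi> w" using elim(2) \<xi>(2)[of w] by (simp add: field_simps)
        then have "a w \<le> (c - r w) / \<xi> w" using elim(1) by blast
        then show ?thesis using \<xi>(2)[of w] real by (simp add: field_simps)
      qed (use elim(2) in auto)
    qed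
  qed
  have neg: "AE w in M. ereal (r w + - \<xi> w * a w) \<le> g (y \<oplus>\<^bsub>E\<^esub> sc (\<lambda>w. - \<xi> w) h) w"
    if yr: "(y, r) \<in> G" and \<xi> [measurable]: "\<xi> \<in> borel_measurable M" and \<xi>_pos: "\<And>w. 0 < \<xi> w"
    for y r \<xi>
  proof -
    let ?g = "g (y \<oplus>\<^bsub>E\<^esub> sc (\<lambda>w. - \<xi> w) h)"
    \<comment> \<open>Where \<open>?g\<close> is infinite the inequality for \<open>a\<close> is
      trivial, but \<open>q\<close> must still be real and below all forward slopes;
      \<open>p0\<close> fills the gap.\<close>
    define q where "q w = (if ?g w = \<infinity> then p0 w else (r w - real_of_ereal (?g w)) / \<xi> w)" for w
    have yc: "y \<oplus>\<^bsub>E\<^esub> sc (\<lambda>w. - \<xi> w) h \<in> carrier E"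
      and [measurable]: "r \<in> borel_measurable M" "p0 \<in> borel_measurable M"
      using minorant_graphD[OF G] yr h p0 by (auto simp: P_def)
    have "q \<in> P"
      unfolding P_def
    proof (intro CollectI conjI allI impI)
      have [measurable]: "?g \<in> borel_measurable M" using yc by simp
      show "q \<in> borel_measurable M" unfolding q_def[abs_def] by measurable
      fix y' r' and \<xi>' :: "'w \<Rightarrow> real" assume *: "(y', r') \<in> G" "\<xi>' \<in> borel_measurable M" "\<forall>w. 0 < \<xi>' w"
      have "AE w in M. ereal (r' w + \<xi>' w * p0 w) \<le> g (y' \<oplus>\<^bsub>E\<^esub> sc \<xi>' h) w"
        using p0 * unfolding P_def by blast
      moreover have "AE w in M. ?g w \<noteq> \<infinity> \<longrightarrow>
          ereal (r' w + \<xi>' w * ((r w - real_of_ereal (?g w)) / \<xi> w)) \<le> g (y' \<oplus>\<^bsub>E\<^esub> sc \<xi>' h) w"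
        using minorant_graph_slope_le[OF G h *(1) yr *(2) \<xi>] *(3) \<xi>_pos by blast
      ultimately show "AE w in M. ereal (r' w + \<xi>' w * q w) \<le> g (y' \<oplus>\<^bsub>E\<^esub> sc \<xi>' h) w"
        by eventually_elim (auto simp: q_def)
    qed
    from ub[OF this] g_not_MInf[OF yc] show ?thesis
    proof eventually_elim
      case (elim w)
      then show ?case
        using \<xi>_pos[of w] by (cases "?g w") (auto simp: q_def field_simps)
    qed
  qed
  have "AE w in M. ereal (r w + \<xi> w * a w) \<le> g (y \<oplus>\<^bsub>E\<^esub> sc \<xi> h) w"
    if yr: "(y, r) \<in> G" and [measurable]: "\<xi> \<in> borel_measurable M" for y r \<xi>
  proof -
    \<comment> \<open>The default 1 keeps both auxiliary coefficients positive everywhere, as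
      \<open>pos\<close> and \<open>neg\<close> require. Locality then transfers each inequality to
      the region where \<xi> has the corresponding sign.\<close>
    define \<xi>p where "\<xi>p w = (if 0 < \<xi> w then \<xi> w else 1)" for w
    define \<xi>n where "\<xi>n w = (if \<xi> w < 0 then - \<xi> w else 1)" for w
    have [measurable]: "\<xi>p \<in> borel_measurable M" "\<xi>n \<in> borel_measurable M"
      unfolding \<xi>p_def[abs_def] \<xi>n_def[abs_def] by measurable
    have y: "y \<in> carrier E" using minorant_graphD(1)[OF G yr] .
    have "AE w in M. ereal (r w + \<xi>p w * a w) \<le> g (y \<oplus>\<^bsub>E\<^esub> sc \<xi>p h) w"
      by (rule pos[OF yr]) (auto simp: \<xi>p_def)
    moreover have "AE w in M. ereal (r w + - \<xi>n w * a w) \<le> g (y \<oplus>\<^bsub>E\<^esub> sc (\<lambda>w. - \<xi>n w) h) w"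
      by (rule neg[OF yr]) (auto simp: \<xi>n_def)
    moreover have "AE w in M. ereal (r w) \<le> g (y \<oplus>\<^bsub>E\<^esub> sc (\<lambda>_. 0) h) w"
      using minorant_graphD(6)[OF G yr] y h by simp
    moreover have "AE w in M. \<xi> w = \<xi>p w \<longrightarrow> g (y \<oplus>\<^bsub>E\<^esub> sc \<xi> h) w = g (y \<oplus>\<^bsub>E\<^esub> sc \<xi>p h) w"
      "AE w in M. \<xi> w = - \<xi>n w \<longrightarrow> g (y \<oplus>\<^bsub>E\<^esub> sc \<xi> h) w = g (y \<oplus>\<^bsub>E\<^esub> sc (\<lambda>w. - \<xi>n w) h) w"
      "AE w in M. \<xi> w = 0 \<longrightarrow> g (y \<oplus>\<^bsub>E\<^esub> sc \<xi> h) w = g (y \<oplus>\<^bsub>E\<^esub> sc (\<lambda>_. 0) h) w"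
      by (rule g_local_sc[OF y h]; measurable)+
    ultimately show ?thesis
    proof eventually_elim
      case (elim w)
      consider "0 < \<xi> w" | "\<xi> w < 0" | "\<xi> w = 0" by linarith
      then show ?case using elim by cases (auto simp: \<xi>p_def \<xi>n_def)
    qed
  qed
  with a that show thesis by blast
qed

text \<open>A relation can be generated by \<open>h\<close> without asking whether an element has
  several representations y + \<xi> h. The substantial condition is the bound by \<open>g\<close>,
  supplied by \<open>minorant_graph_value\<close>.\<close>

lemma minorant_graph_extend:
  assumes G: "minorant_graph G" and h: "h \<in> carrier E"
  obtains G' a where "minorant_graph G'" "G \<subseteq> G'" "(h, a) \<in> G'"
proof -
  obtain a where [measurable]: "a \<in> borel_measurable M"
    and le: "\<And>y r \<xi>. (y, r) \<in> G \<Longrightarrow> \<xi> \<in> borel_measurable M \<Longrightarrow>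
      AE w in M. ereal (r w + \<xi> w * a w) \<le> g (y \<oplus>\<^bsub>E\<^esub> sc \<xi> h) w"
    using minorant_graph_value[OF G h] by blast
  define G' where "G' = {(y \<oplus>\<^bsub>E\<^esub> sc \<xi> h, \<lambda>w. r w + \<xi> w * a w) | y r \<xi>.
    (y, r) \<in> G \<and> \<xi> \<in> borel_measurable M}"
  have G'I: "(x, s) \<in> G'" if "(y, r) \<in> G" "\<xi> \<in> borel_measurable M"
    "x = y \<oplus>\<^bsub>E\<^esub> sc \<xi> h" "s = (\<lambda>w. r w + \<xi> w * a w)" for x s y r \<xi>
    using that unfolding G'_def by blast
  note D = minorant_graphD[OF G]
  have sub: "G \<subseteq> G'"
  proof (rule subrelI)
    fix y r assume yr: "(y, r) \<in> G"
    show "(y, r) \<in> G'" by (rule G'I[OF yr, of "\<lambda>_. 0"]) (use D(1)[OF yr] h in auto)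
  qed
  have "minorant_graph G'"
    unfolding minorant_graph_def
  proof (intro conjI allI impI)
    show "G' \<subseteq> carrier E \<times> borel_measurable M"
      using D(1,2) h by (auto simp: G'_def)
    show "(\<zero>\<^bsub>E\<^esub>, \<lambda>_. 0) \<in> G'" using sub D(3) by blast
  next
    fix x1 s1 x2 s2 assume "(x1, s1) \<in> G'" "(x2, s2) \<in> G'"
    then obtain y1 r1 \<xi>1 y2 r2 \<xi>2 where *: "(y1, r1) \<in> G" "(y2, r2) \<in> G"
      and [measurable]: "\<xi>1 \<in> borel_measurable M" "\<xi>2 \<in> borel_measurable M"
      and eq: "x1 = y1 \<oplus>\<^bsub>E\<^esub> sc \<xi>1 h" "s1 = (\<lambda>w. r1 w + \<xi>1 w * a w)"
        "x2 = y2 \<oplus>\<^bsub>E\<^esub> sc \<xi>2 h" "s2 = (\<lambda>w. r2 w + \<xi>2 w * a w)"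
      unfolding G'_def by blast
    show "(x1 \<oplus>\<^bsub>E\<^esub> x2, \<lambda>w. s1 w + s2 w) \<in> G'"
      by (rule G'I[OF D(4)[OF *], of "\<lambda>w. \<xi>1 w + \<xi>2 w"])
        (use D(1) * h in \<open>auto simp: eq sc_add_left[symmetric] add_swap algebra_simps\<close>)
  next
    fix x s and \<phi> :: "'w \<Rightarrow> real" assume "(x, s) \<in> G'" and [measurable]: "\<phi> \<in> borel_measurable M"
    then obtain y r \<xi> where *: "(y, r) \<in> G" and [measurable]: "\<xi> \<in> borel_measurable M"
      and eq: "x = y \<oplus>\<^bsub>E\<^esub> sc \<xi> h" "s = (\<lambda>w. r w + \<xi> w * a w)"
      unfolding G'_def by blast
    show "(sc \<phi> x, \<lambda>w. \<phi> w * s w) \<in> G'"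
      by (rule G'I[OF D(5)[OF *, of \<phi>], of "\<lambda>w. \<phi> w * \<xi> w"])
        (use D(1) * h in \<open>auto simp: eq sc_add_right sc_sc algebra_simps\<close>)
  next
    fix x s assume "(x, s) \<in> G'"
    then show "AE w in M. ereal (s w) \<le> g x w" using le unfolding G'_def by blast
  qed
  moreover have "(h, a) \<in> G'"
    by (rule G'I[OF D(3), of "\<lambda>_. 1"]) (use h in auto)
  ultimately show thesis using sub that by blast
qed

section \<open>Maximal graphs and everywhere defined homomorphisms\<close>

lemma minorant_graph_Union:
  assumes "C \<noteq> {}" and chain: "subset.chain {G. minorant_graph G} C"
  shows "minorant_graph (\<Union>C)"
proof -
  have C: "\<And>G. G \<in> C \<Longrightarrow> minorant_graph G" using chain by (auto simp: subset.chain_def)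
  show ?thesis
    unfolding minorant_graph_def
  proof (intro conjI allI impI)
    show "\<Union>C \<subseteq> carrier E \<times> borel_measurable M"
      using C unfolding minorant_graph_def by blast
    show "(\<zero>\<^bsub>E\<^esub>, \<lambda>_. 0) \<in> \<Union>C" using \<open>C \<noteq> {}\<close> C minorant_graphD(3) by blast
  next
    fix x r y s assume "(x, r) \<in> \<Union>C" "(y, s) \<in> \<Union>C"
    then obtain G H where GH: "G \<in> C" "H \<in> C" "(x, r) \<in> G" "(y, s) \<in> H" by blast
    then have "G \<subseteq> H \<or> H \<subseteq> G" using chain by (auto simp: subset.chain_def)
    then obtain K where "K \<in> C" "(x, r) \<in> K" "(y, s) \<in> K" using GH by blast
    then show "(x \<oplus>\<^bsub>E\<^esub> y, \<lambda>w. r w + s w) \<in> \<Union>C" using C minorant_graphD(4) by blast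
  next
    fix x r and \<phi> :: "'w \<Rightarrow> real" assume "(x, r) \<in> \<Union>C" "\<phi> \<in> borel_measurable M"
    then show "(sc \<phi> x, \<lambda>w. \<phi> w * r w) \<in> \<Union>C" using C minorant_graphD(5) by blast
  next
    fix x r assume "(x, r) \<in> \<Union>C"
    then show "AE w in M. ereal (r w) \<le> g x w" using C minorant_graphD(6) by blast
  qed
qed

text \<open>A maximal graph has a value over every element, since it could otherwise be extended
  there. The values of \<open>v\<close> are chosen functions, so linearity holds almost everywhere,
  by uniqueness over the same element.\<close>

theorem hahn_banach:
  obtains v where "\<And>x. x \<in> carrier E \<Longrightarrow> v x \<in> borel_measurable M"
    "\<And>x y. x \<in> carrier E \<Longrightarrow> y \<in> carrier E \<Longrightarrow> AE w in M. v (x \<oplus>\<^bsub>E\<^esub> y) w = v x w + v y w"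
    "\<And>x \<phi>. x \<in> carrier E \<Longrightarrow> \<phi> \<in> borel_measurable M \<Longrightarrow> AE w in M. v (sc \<phi> x) w = \<phi> w * v x w"
    "\<And>x. x \<in> carrier E \<Longrightarrow> AE w in M. ereal (v x w) \<le> g x w"
proof -
  have "minorant_graph {(\<zero>\<^bsub>E\<^esub>, \<lambda>_. 0)}"
    using g_zero by (auto simp: minorant_graph_def zero_ereal_def[symmetric] elim: eventually_mono)
  then have "{G. minorant_graph G} \<noteq> {}" by blast
  from subset_Zorn_nonempty[OF this] minorant_graph_Union
  obtain G where G: "minorant_graph G" and max: "\<And>H. minorant_graph H \<Longrightarrow> G \<subseteq> H \<Longrightarrow> H = G"
    by (metis mem_Collect_eq)
  have "\<exists>a. (x, a) \<in> G" if "x \<in> carrier E" for x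
    using minorant_graph_extend[OF G that] max by metis
  then obtain v where v: "\<And>x. x \<in> carrier E \<Longrightarrow> (x, v x) \<in> G" by metis
  note D = minorant_graphD[OF G]
  show thesis
  proof (rule that[of v])
    fix x y assume xy: "x \<in> carrier E" "y \<in> carrier E"
    show "AE w in M. v (x \<oplus>\<^bsub>E\<^esub> y) w = v x w + v y w"
      by (rule minorant_graph_unique[OF G v D(4)[OF v v]]) (use xy in auto)
  next
    fix x and \<phi> :: "'w \<Rightarrow> real" assume x: "x \<in> carrier E" "\<phi> \<in> borel_measurable M"
    show "AE w in M. v (sc \<phi> x) w = \<phi> w * v x w"
      by (rule minorant_graph_unique[OF G v D(5)[OF v]]) (use x in auto)
  qed (use v D in auto)
qed


subsection \<open>The barrel of a convex function\<close>

text \<open>As \<open>g\<close> need not be even, the condition at the negative of \<open>h\<close>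
  is what makes the set balanced and bounds homomorphisms below \<open>g\<close> on both sides. The
  level lies above the value 0 at the null element, which leaves room for absorption.\<close>

definition unit_sublevel :: "'e set"
  where "unit_sublevel = {h \<in> carrier E. (AE w in M. g h w \<le> 1) \<and> (AE w in M. g (sc (\<lambda>_. -1) h) w \<le> 1)}"

lemma sublevel_convex:
  assumes "x \<in> carrier E" "y \<in> carrier E" "\<phi> \<in> borel_measurable M"
    and \<phi>: "AE w in M. 0 \<le> \<phi> w \<and> \<phi> w \<le> 1"
    and le: "AE w in M. g x w \<le> 1" "AE w in M. g y w \<le> 1"
  shows "AE w in M. g (sc \<phi> x \<oplus>\<^bsub>E\<^esub> sc (\<lambda>w. 1 - \<phi> w) y) w \<le> 1"
  using g_convex[OF assms(1-4)] \<phi> le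
proof eventually_elim
  case (elim w)
  have "ereal (\<phi> w) * g x w + ereal (1 - \<phi> w) * g y w \<le> ereal (\<phi> w) * 1 + ereal (1 - \<phi> w) * 1"
    using elim by (intro add_mono ereal_mult_left_mono) auto
  also have "\<dots> = 1" by (simp add: one_ereal_def)
  finally show ?case using elim(1) by simp
qed

lemma unit_sublevel_combination:
  assumes x: "x \<in> unit_sublevel" and y: "y \<in> unit_sublevel"
    and [measurable]: "\<phi> \<in> borel_measurable M" and \<phi>: "AE w in M. 0 \<le> \<phi> w \<and> \<phi> w \<le> 1"
  shows "sc \<phi> x \<oplus>\<^bsub>E\<^esub> sc (\<lambda>w. 1 - \<phi> w) y \<in> unit_sublevel"
proof -
  have c: "x \<in> carrier E" "y \<in> carrier E" using x y by (auto simp: unit_sublevel_def)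
  have "sc (\<lambda>_. -1) (sc \<phi> x \<oplus>\<^bsub>E\<^esub> sc (\<lambda>w. 1 - \<phi> w) y)
      = sc \<phi> (sc (\<lambda>_. -1) x) \<oplus>\<^bsub>E\<^esub> sc (\<lambda>w. 1 - \<phi> w) (sc (\<lambda>_. -1) y)"
    by (rule sc_combination[symmetric]) (use c in auto)
  moreover have "AE w in M. g (sc \<phi> x \<oplus>\<^bsub>E\<^esub> sc (\<lambda>w. 1 - \<phi> w) y) w \<le> 1"
    by (rule sublevel_convex) (use x y \<phi> in \<open>simp_all add: unit_sublevel_def\<close>)
  moreover have "AE w in M. g (sc \<phi> (sc (\<lambda>_. -1) x) \<oplus>\<^bsub>E\<^esub> sc (\<lambda>w. 1 - \<phi> w) (sc (\<lambda>_. -1) y)) w \<le> 1"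
    by (rule sublevel_convex) (use x y \<phi> in \<open>simp_all add: unit_sublevel_def\<close>)
  ultimately show ?thesis using c by (simp add: unit_sublevel_def)
qed

lemma unit_sublevel_neg:
  assumes "x \<in> unit_sublevel"
  shows "sc (\<lambda>_. -1) x \<in> unit_sublevel"
  using assms by (auto simp: unit_sublevel_def sc_sc)

text \<open>With weights (1 + \<phi>) / 2 and (1 - \<phi>) / 2, the element \<phi> x is a convex
  combination of x and -x; symmetry and convexity thus give balancedness.\<close>

lemma unit_sublevel_scale:
  assumes x: "x \<in> unit_sublevel" and [measurable]: "\<phi> \<in> borel_measurable M"
    and \<phi>: "AE w in M. \<bar>\<phi> w\<bar> \<le> 1"
  shows "sc \<phi> x \<in> unit_sublevel"
proof -
  have c: "x \<in> carrier E" using x by (auto simp: unit_sublevel_def)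
  have "sc (\<lambda>w. (1 + \<phi> w) / 2) x \<oplus>\<^bsub>E\<^esub> sc (\<lambda>w. 1 - (1 + \<phi> w) / 2) (sc (\<lambda>_. -1) x) \<in> unit_sublevel"
    by (rule unit_sublevel_combination[OF x unit_sublevel_neg[OF x]])
      (use \<phi> in \<open>auto elim: eventually_mono\<close>)
  also have "sc (\<lambda>w. (1 + \<phi> w) / 2) x \<oplus>\<^bsub>E\<^esub> sc (\<lambda>w. 1 - (1 + \<phi> w) / 2) (sc (\<lambda>_. -1) x) = sc \<phi> x"
    using c by (simp add: sc_sc sc_add_left field_simps)
  finally show ?thesis .
qed

lemma L0_balanced_unit_sublevel: "L0_balanced M E unit_sublevel"
  unfolding L0_balanced_def
proof (intro conjI ballI impI)
  fix \<eta> x assume "\<eta> \<in> carrier (L0 M)" and le: "L0_le M (L0_abs M \<eta>) \<one>\<^bsub>L0 M\<^esub>" and x: "x \<in> unit_sublevel"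
  then obtain \<phi> where [measurable]: "\<phi> \<in> borel_measurable M" and \<eta>: "\<eta> = ae_class M \<phi>"
    by (auto elim: L0_carrierE)
  have "AE w in M. \<bar>\<phi> w\<bar> \<le> 1"
    using le by (simp add: \<eta> L0_one L0_abs_def L0_map_ae_class L0_rel_ae_class)
  then show "\<eta> \<odot>\<^bsub>E\<^esub> x \<in> unit_sublevel"
    using unit_sublevel_scale[OF x, of \<phi>] by (simp add: \<eta> sc_def)
qed (auto simp: unit_sublevel_def)

lemma L0_convex_unit_sublevel: "L0_convex M E unit_sublevel"
  unfolding L0_convex_def
proof (intro conjI ballI impI)
  fix x y \<xi> assume x: "x \<in> unit_sublevel" and y: "y \<in> unit_sublevel"
    and \<xi>: "\<xi> \<in> L0_pos M" "L0_le M \<xi> \<one>\<^bsub>L0 M\<^esub>"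
  then obtain \<phi> where [measurable]: "\<phi> \<in> borel_measurable M" and \<phi>: "\<xi> = ae_class M \<phi>"
    by (auto simp: L0_pos_def elim: L0_carrierE)
  have "AE w in M. 0 \<le> \<phi> w \<and> \<phi> w \<le> 1"
    using \<xi> by (simp add: \<phi> L0_pos_def L0_one L0_zero L0_rel_ae_class)
  from unit_sublevel_combination[OF x y _ this]
  show "\<xi> \<odot>\<^bsub>E\<^esub> x \<oplus>\<^bsub>E\<^esub> (\<one>\<^bsub>L0 M\<^esub> \<ominus>\<^bsub>L0 M\<^esub> \<xi>) \<odot>\<^bsub>E\<^esub> y \<in> unit_sublevel"
    by (simp add: \<phi> L0_one L0_minus_ae_class sc_def)
qed (auto simp: unit_sublevel_def)

lemma unit_sublevel_small:
  assumes x: "x \<in> carrier E"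
  obtains \<delta> where "\<delta> \<in> borel_measurable M" "\<And>w. 0 < \<delta> w" "sc \<delta> x \<in> unit_sublevel"
proof -
  obtain \<epsilon> where \<epsilon> [measurable]: "\<epsilon> \<in> borel_measurable M" and \<epsilon>_pos: "\<And>w. 0 < \<epsilon> w"
    and fin: "AE w in M. g (sc \<epsilon> x) w < \<infinity>" "AE w in M. g (sc (\<lambda>w. - \<epsilon> w) x) w < \<infinity>"
    using g_absorb[OF x] by blast
  have cl: "sc \<epsilon> x \<in> carrier E" "sc (\<lambda>w. - \<epsilon> w) x \<in> carrier E" using x by auto
  note [measurable] = g_measurable[OF cl(1)] g_measurable[OF cl(2)]
  \<comment> \<open>A common finite bound for both directions. The 1 keeps the reciprocal of
    \<open>c\<close> in [0, 1], so that it can serve as a convex weight.\<close>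
  define c where "c w = max 1 (max (real_of_ereal (g (sc \<epsilon> x) w))
    (real_of_ereal (g (sc (\<lambda>w. - \<epsilon> w) x) w)))" for w
  have [measurable]: "c \<in> borel_measurable M" unfolding c_def[abs_def] by measurable
  have c: "1 \<le> c w" for w by (simp add: c_def)
  then have c_pos: "0 < c w" for w by (rule less_le_trans[OF zero_less_one])
  \<comment> \<open>Contracting towards the null element, where \<open>g\<close> is 0, divides the
    bound \<open>c\<close> by itself.\<close>
  have shrink: "AE w in M. g (sc (\<lambda>w. 1 / c w) y) w \<le> 1"
    if y: "y \<in> carrier E" and le: "AE w in M. g y w \<le> ereal (c w)" for y
  proof -
    have "AE w in M. g (sc (\<lambda>w. 1 / c w) y \<oplus>\<^bsub>E\<^esub> sc (\<lambda>w. 1 - 1 / c w) \<zero>\<^bsub>E\<^esub>) w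
        \<le> ereal (1 / c w) * g y w + ereal (1 - 1 / c w) * g \<zero>\<^bsub>E\<^esub> w"
      by (rule g_convex) (use y c c_pos in \<open>auto simp: less_imp_le\<close>)
    with le g_zero show ?thesis
    proof eventually_elim
      case (elim w)
      have "ereal (1 / c w) * g y w \<le> ereal (1 / c w) * ereal (c w)"
        using elim(1) c_pos[of w] by (intro ereal_mult_left_mono) auto
      also have "\<dots> = 1" using c_pos[of w] by simp
      finally show ?case using elim(2,3) y by (auto intro: order_trans)
    qed
  qed
  have "AE w in M. g (sc \<epsilon> x) w \<le> ereal (c w)"
    using fin(1)
  proof eventually_elim
    case (elim w)
    moreover have "real_of_ereal (g (sc \<epsilon> x) w) \<le> c w" by (simp add: c_def)
    ultimately show ?case by (cases "g (sc \<epsilon> x) w") auto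
  qed
  from shrink[OF cl(1) this] have 1: "AE w in M. g (sc (\<lambda>w. 1 / c w * \<epsilon> w) x) w \<le> 1"
    using x by (simp add: sc_sc)
  have "AE w in M. g (sc (\<lambda>w. - \<epsilon> w) x) w \<le> ereal (c w)"
    using fin(2)
  proof eventually_elim
    case (elim w)
    moreover have "real_of_ereal (g (sc (\<lambda>w. - \<epsilon> w) x) w) \<le> c w" by (simp add: c_def)
    ultimately show ?case by (cases "g (sc (\<lambda>w. - \<epsilon> w) x) w") auto
  qed
  from shrink[OF cl(2) this] have 2: "AE w in M. g (sc (\<lambda>w. 1 / c w * - \<epsilon> w) x) w \<le> 1"
    using x by (simp add: sc_sc)
  show thesis
  proof (rule that)
    show "(\<lambda>w. 1 / c w * \<epsilon> w) \<in> borel_measurable M" by measurable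
    show "0 < 1 / c w * \<epsilon> w" for w using c_pos[of w] \<epsilon>_pos[of w] by simp
    show "sc (\<lambda>w. 1 / c w * \<epsilon> w) x \<in> unit_sublevel"
      using 1 2 x by (simp add: unit_sublevel_def sc_sc)
  qed
qed

lemma L0_absorbent_unit_sublevel: "L0_absorbent M E unit_sublevel"
  unfolding L0_absorbent_def
proof (intro conjI ballI)
  fix x assume x: "x \<in> carrier E"
  obtain \<delta> where \<delta> [measurable]: "\<delta> \<in> borel_measurable M" and pos: "\<And>w. 0 < \<delta> w"
    and mem: "sc \<delta> x \<in> unit_sublevel"
    using unit_sublevel_small[OF x] by blast
  show "\<exists>\<xi>\<in>L0_spos M. \<forall>\<eta>\<in>carrier (L0 M). L0_le M (L0_abs M \<eta>) \<xi> \<longrightarrow> \<eta> \<odot>\<^bsub>E\<^esub> x \<in> unit_sublevel"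
  proof (intro bexI ballI impI)
    show "ae_class M \<delta> \<in> L0_spos M" using pos by (intro L0_sposI) auto
    fix \<eta> assume "\<eta> \<in> carrier (L0 M)" and le: "L0_le M (L0_abs M \<eta>) (ae_class M \<delta>)"
    then obtain \<phi> where [measurable]: "\<phi> \<in> borel_measurable M" and \<eta>: "\<eta> = ae_class M \<phi>"
      by (auto elim: L0_carrierE)
    have "AE w in M. \<bar>\<phi> w\<bar> \<le> \<delta> w"
      using le by (simp add: \<eta> L0_abs_def L0_map_ae_class L0_rel_ae_class)
    \<comment> \<open>Dividing by \<delta> reduces absorption to balancedness at
      \<open>sc \<delta> x\<close>.\<close>
    then have "AE w in M. \<bar>\<phi> w / \<delta> w\<bar> \<le> 1"
      by eventually_elim (use pos in \<open>auto simp: abs_of_pos field_simps\<close>)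
    from unit_sublevel_scale[OF mem _ this]
    have "sc (\<lambda>w. \<phi> w / \<delta> w) (sc \<delta> x) \<in> unit_sublevel" by simp
    also have "sc (\<lambda>w. \<phi> w / \<delta> w) (sc \<delta> x) = sc \<phi> x"
      using x pos by (simp add: sc_sc less_imp_neq[symmetric])
    finally show "\<eta> \<odot>\<^bsub>E\<^esub> x \<in> unit_sublevel" by (simp add: \<eta> sc_def)
  qed
qed (auto simp: unit_sublevel_def)

lemma countable_concatenation_unit_sublevel:
  assumes "countable_concatenation M E (carrier E)"
  shows "countable_concatenation M E unit_sublevel"
  unfolding countable_concatenation_def
proof (intro allI impI)
  fix X :: "nat \<Rightarrow> 'e" and A assume asm: "range X \<subseteq> unit_sublevel \<and> countable_partition M A"
  then have X: "X n \<in> unit_sublevel" for n by blast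
  then have Xc: "X n \<in> carrier E" for n by (auto simp: unit_sublevel_def)
  have A [measurable]: "A n \<in> sets M" and UN: "(\<Union>n. A n) = space M" for n
    using asm by (auto simp: countable_partition_def)
  obtain x where x: "x \<in> carrier E"
    and eq: "\<And>n. L0_indicator M (A n) \<odot>\<^bsub>E\<^esub> x = L0_indicator M (A n) \<odot>\<^bsub>E\<^esub> X n"
    using assms asm Xc unfolding countable_concatenation_def by (metis image_subset_iff)
  have eq': "sc (indicator (A n)) x = sc (indicator (A n)) (X n)" for n
    using eq by (simp add: sc_def L0_indicator_def)
  \<comment> \<open>Needed twice, for the glued element and for its negative. Locality gives the
    bound on each \<open>A n\<close>, and countably many null sets are discarded.\<close>
  have patch: "AE w in M. g y w \<le> 1"
    if y: "y \<in> carrier E" and Y: "\<And>n. Y n \<in> carrier E" "\<And>n. AE w in M. g (Y n) w \<le> 1"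
      and eqY: "\<And>n. sc (indicator (A n)) y = sc (indicator (A n)) (Y n)" for y Y
  proof -
    have "AE w in M. w \<in> A n \<longrightarrow> g y w \<le> 1" for n
      using g_local[OF y Y(1) A eqY, of n] Y(2)[of n] by eventually_elim auto
    then have "AE w in M. \<forall>n. w \<in> A n \<longrightarrow> g y w \<le> 1"
      unfolding AE_all_countable by blast
    with AE_space show ?thesis by eventually_elim (use UN in blast)
  qed
  have "AE w in M. g x w \<le> 1"
    by (rule patch[OF x, of X]) (use X Xc eq' in \<open>auto simp: unit_sublevel_def\<close>)
  moreover have "AE w in M. g (sc (\<lambda>_. -1) x) w \<le> 1"
  proof (rule patch)
    fix n
    have comm: "sc (indicator (A n)) (sc (\<lambda>_. -1) y) = sc (\<lambda>_. -1) (sc (indicator (A n)) y)"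
      if "y \<in> carrier E" for y using that by (simp add: sc_sc)
    show "sc (indicator (A n)) (sc (\<lambda>_. -1) x) = sc (indicator (A n)) (sc (\<lambda>_. -1) (X n))"
      using comm x Xc eq' by simp
  qed (use X Xc x in \<open>auto simp: unit_sublevel_def\<close>)
  ultimately show "\<exists>x\<in>unit_sublevel. \<forall>n.
      L0_indicator M (A n) \<odot>\<^bsub>E\<^esub> x = L0_indicator M (A n) \<odot>\<^bsub>E\<^esub> X n"
    using x eq by (auto simp: unit_sublevel_def)
qed

end

section \<open>Locally convex modules\<close>

lemma topspace_L0_topology [simp]: "topspace (L0_topology M) = carrier (L0 M)"
proof -
  have "ae_class M (\<lambda>_. 1) \<in> L0_spos M" by (rule L0_sposI) auto
  then have "openin (L0_topology M) (carrier (L0 M))"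
    by (auto simp: openin_L0_topology L0_cball_def)
  then show ?thesis
    by (metis openin_L0_topology openin_subset openin_topspace subset_antisym)
qed

lemma L0_cball_ae_class:
  assumes "\<phi> \<in> borel_measurable M" "\<psi> \<in> borel_measurable M" "e \<in> borel_measurable M"
  shows "ae_class M \<psi> \<in> L0_cball M (ae_class M \<phi>) (ae_class M e) \<longleftrightarrow>
    (AE w in M. \<bar>\<psi> w - \<phi> w\<bar> \<le> e w)"
  using assms by (simp add: L0_cball_def L0_minus_ae_class L0_abs_def L0_map_ae_class L0_rel_ae_class)

context locally_L0_convex_module
begin

text \<open>Serves both the rescaling (y - x) / e in the continuity of homomorphisms and the maps x
  + h and x - h in the closedness of the barrel.\<close>

lemma continuous_affine:
  assumes "x \<in> carrier E" "a \<in> carrier (L0 M)"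
  shows "continuous_map T T (\<lambda>y. x \<oplus>\<^bsub>E\<^esub> a \<odot>\<^bsub>E\<^esub> y)"
proof -
  have "continuous_map T (prod_topology (L0_topology M) T) (\<lambda>y. (a, y))"
    using assms by (simp add: continuous_map_pairedI)
  from continuous_map_compose[OF this continuous_smult]
  have "continuous_map T T (\<lambda>y. a \<odot>\<^bsub>E\<^esub> y)" by (simp add: o_def)
  then have "continuous_map T (prod_topology T T) (\<lambda>y. (x, a \<odot>\<^bsub>E\<^esub> y))"
    using assms by (simp add: continuous_map_pairedI topspace_carrier)
  from continuous_map_compose[OF this continuous_add] show ?thesis by (simp add: o_def)
qed

text \<open>Here the scalar varies and the direction is fixed: a neighbourhood in the module is
  pulled back to a ball of scalars, which is how interior points yield absorption.\<close>

lemma continuous_line: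
  assumes "x \<in> carrier E" "h \<in> carrier E"
  shows "continuous_map (L0_topology M) T (\<lambda>\<eta>. x \<oplus>\<^bsub>E\<^esub> \<eta> \<odot>\<^bsub>E\<^esub> h)"
proof -
  have "continuous_map (L0_topology M) (prod_topology (L0_topology M) T) (\<lambda>\<eta>. (\<eta>, h))"
    using assms by (simp add: continuous_map_pairedI topspace_carrier)
  from continuous_map_compose[OF this continuous_smult]
  have "continuous_map (L0_topology M) T (\<lambda>\<eta>. \<eta> \<odot>\<^bsub>E\<^esub> h)" by (simp add: o_def)
  then have "continuous_map (L0_topology M) (prod_topology T T) (\<lambda>\<eta>. (x, \<eta> \<odot>\<^bsub>E\<^esub> h))"
    using assms by (simp add: continuous_map_pairedI topspace_carrier)
  from continuous_map_compose[OF this continuous_add] show ?thesis by (simp add: o_def)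
qed

text \<open>By homogeneity over random scalars, a bound by 1 near the null element rescales to a
  bound by any positive random variable near any point.\<close>

lemma L0_dual_bounded:
  assumes v [measurable]: "\<And>x. x \<in> carrier E \<Longrightarrow> v x \<in> borel_measurable M"
    and v_add: "\<And>x y. x \<in> carrier E \<Longrightarrow> y \<in> carrier E \<Longrightarrow> AE w in M. v (x \<oplus>\<^bsub>E\<^esub> y) w = v x w + v y w"
    and v_sc: "\<And>x \<phi>. x \<in> carrier E \<Longrightarrow> \<phi> \<in> borel_measurable M \<Longrightarrow>
      AE w in M. v (sc \<phi> x) w = \<phi> w * v x w"
    and B: "\<zero>\<^bsub>E\<^esub> \<in> T interior_of B" and bound: "\<And>x. x \<in> B \<Longrightarrow> AE w in M. \<bar>v x w\<bar> \<le> 1"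
  shows "(\<lambda>x. ae_class M (v x)) \<in> L0_dual M E T"
  unfolding L0_dual_def
proof (intro CollectI conjI ballI Pi_I)
  fix x assume x: "x \<in> carrier E"
  then show "ae_class M (v x) \<in> carrier (L0 M)" by simp
  show "ae_class M (v (x \<oplus>\<^bsub>E\<^esub> y)) = ae_class M (v x) \<oplus>\<^bsub>L0 M\<^esub> ae_class M (v y)"
    if "y \<in> carrier E" for y
    using x that v_add[OF x that] by (simp add: L0_ring_ops ae_class_eq_iff)
next
  fix \<xi> x assume "\<xi> \<in> carrier (L0 M)" and x: "x \<in> carrier E"
  then obtain \<phi> where \<phi> [measurable]: "\<phi> \<in> borel_measurable M" and \<xi>: "\<xi> = ae_class M \<phi>"
    by (auto elim: L0_carrierE)
  have "\<xi> \<odot>\<^bsub>E\<^esub> x = sc \<phi> x" by (simp add: \<xi> sc_def)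
  then show "ae_class M (v (\<xi> \<odot>\<^bsub>E\<^esub> x)) = \<xi> \<otimes>\<^bsub>L0 M\<^esub> ae_class M (v x)"
    using x v_sc[OF x \<phi>] by (simp add: \<xi> L0_ring_ops ae_class_eq_iff)
next
  let ?u = "\<lambda>x. ae_class M (v x)"
  show "continuous_map T (L0_topology M) ?u"
    unfolding continuous_map
  proof (intro conjI allI impI)
    show "?u ` topspace T \<subseteq> topspace (L0_topology M)" by (auto simp: topspace_carrier)
    fix W assume W: "openin (L0_topology M) W"
    show "openin T {x \<in> topspace T. ?u x \<in> W}"
    proof (subst openin_subopen, intro ballI)
      fix x assume "x \<in> {x \<in> topspace T. ?u x \<in> W}"
      then have x: "x \<in> carrier E" and "?u x \<in> W" by (auto simp: topspace_carrier)
      then obtain \<epsilon> where "\<epsilon> \<in> L0_spos M" "L0_cball M (?u x) \<epsilon> \<subseteq> W"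
        using W by (auto simp: openin_L0_topology)
      then obtain e where e [measurable]: "e \<in> borel_measurable M" and pos: "\<And>w. 0 < e w"
        and ball: "L0_cball M (?u x) (ae_class M e) \<subseteq> W"
        by (auto elim: L0_sposE)
      \<comment> \<open>This is (y - x) / e. It vanishes at \<open>x\<close>, and if it lies in
        \<open>B\<close>, then \<open>v y\<close> and \<open>v x\<close> differ by at most
        \<open>e\<close>.\<close>
      define \<tau> where "\<tau> y = sc (\<lambda>w. - (1 / e w)) x \<oplus>\<^bsub>E\<^esub> ae_class M (\<lambda>w. 1 / e w) \<odot>\<^bsub>E\<^esub> y" for y
      have \<tau>: "\<tau> y = sc (\<lambda>w. - (1 / e w)) x \<oplus>\<^bsub>E\<^esub> sc (\<lambda>w. 1 / e w) y" for y
        by (simp add: \<tau>_def sc_def)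
      define N where "N = {y \<in> topspace T. \<tau> y \<in> T interior_of B}"
      have "openin T N"
        unfolding N_def \<tau>_def
        by (rule openin_continuous_map_preimage[OF continuous_affine]) (use x in auto)
      moreover have "x \<in> N"
        using x B by (simp add: N_def \<tau> topspace_carrier sc_add_left)
      moreover have "N \<subseteq> {x \<in> topspace T. ?u x \<in> W}"
      proof
        fix y assume "y \<in> N"
        then have y: "y \<in> carrier E" and "\<tau> y \<in> B"
          using interior_of_subset[of T B] by (auto simp: N_def topspace_carrier)
        from bound[OF this(2)]
        have "AE w in M. \<bar>v (sc (\<lambda>w. - (1 / e w)) x \<oplus>\<^bsub>E\<^esub> sc (\<lambda>w. 1 / e w) y) w\<bar> \<le> 1"
          by (simp add: \<tau>)
        moreover have "AE w in M. v (sc (\<lambda>w. - (1 / e w)) x \<oplus>\<^bsub>E\<^esub> sc (\<lambda>w. 1 / e w) y) w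
            = v (sc (\<lambda>w. - (1 / e w)) x) w + v (sc (\<lambda>w. 1 / e w) y) w"
          by (rule v_add) (use x y in auto)
        moreover have "AE w in M. v (sc (\<lambda>w. - (1 / e w)) x) w = - (1 / e w) * v x w"
          by (rule v_sc[OF x]) measurable
        moreover have "AE w in M. v (sc (\<lambda>w. 1 / e w) y) w = 1 / e w * v y w"
          by (rule v_sc[OF y]) measurable
        ultimately have "AE w in M. \<bar>v y w - v x w\<bar> \<le> e w"
        proof eventually_elim
          case (elim w)
          then have "\<bar>(v y w - v x w) / e w\<bar> \<le> 1" by (simp add: diff_divide_distrib)
          then show ?case using pos[of w] by (simp add: abs_divide)
        qed
        then have "?u y \<in> L0_cball M (?u x) (ae_class M e)"
          using x y by (simp add: L0_cball_ae_class)
        then show "y \<in> {x \<in> topspace T. ?u x \<in> W}"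
          using ball y by (auto simp: topspace_carrier)
      qed
      ultimately show "\<exists>N. openin T N \<and> x \<in> N \<and> N \<subseteq> {x \<in> topspace T. ?u x \<in> W}" by blast
    qed
  qed
qed

section \<open>Increments of a convex function at an interior point\<close>

lemma L0_dom_iff:
  assumes "F \<in> borel_measurable M" "f z = ae_class M F" "z \<in> carrier E"
  shows "z \<in> L0_dom M E f \<longleftrightarrow> (AE w in M. \<bar>F w\<bar> < \<infinity>)"
  using assms by (simp add: L0_dom_def L0_map_ae_class L0_rel_ae_class)

text \<open>Finiteness of \<open>F x\<close> almost everywhere makes its subtraction harmless in the
  extended reals. Absorption holds because a small scalar \<eta> keeps x + \<eta> h inside an open
  part of the domain.\<close>

lemma L0_convex_germ_interior:
  assumes F [measurable]: "\<And>z. z \<in> carrier E \<Longrightarrow> F z \<in> borel_measurable M"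
    and f: "\<And>z. z \<in> carrier E \<Longrightarrow> f z = ae_class M (F z)"
    and proper: "L0_proper M E f" and convex: "L0_convex_fun M E f"
    and x_int: "x \<in> T interior_of L0_dom M E f"
  shows "L0_convex_germ M E (\<lambda>h w. F (x \<oplus>\<^bsub>E\<^esub> h) w - F x w)"
proof
  have "x \<in> L0_dom M E f" using x_int interior_of_subset by (metis subsetD)
  then have x: "x \<in> carrier E" by (simp add: L0_dom_def)
  then have fin: "AE w in M. \<bar>F x w\<bar> < \<infinity>"
    using \<open>x \<in> L0_dom M E f\<close> L0_dom_iff F f by blast
  have not_MInf: "AE w in M. F z w \<noteq> -\<infinity>" if "z \<in> carrier E" for z
    using proper that by (auto simp: L0_proper_def f L0_rel_ae_class)
  {
    fix h assume h: "h \<in> carrier E"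
    show "(\<lambda>w. F (x \<oplus>\<^bsub>E\<^esub> h) w - F x w) \<in> borel_measurable M"
      using x h by (intro borel_measurable_ereal_diff F) auto
    have "AE w in M. F (x \<oplus>\<^bsub>E\<^esub> h) w \<noteq> -\<infinity>" using not_MInf x h by auto
    with fin show "AE w in M. F (x \<oplus>\<^bsub>E\<^esub> h) w - F x w \<noteq> -\<infinity>"
    proof eventually_elim
      case (elim w)
      then show ?case by (cases "F (x \<oplus>\<^bsub>E\<^esub> h) w"; cases "F x w") auto
    qed
  next
    show "AE w in M. F (x \<oplus>\<^bsub>E\<^esub> \<zero>\<^bsub>E\<^esub>) w - F x w = 0"
      using fin
    proof eventually_elim
      case (elim w)
      then show ?case using x by (cases "F x w") auto
    qed
  next
    fix h k and \<phi> :: "'w \<Rightarrow> real"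
    assume hk: "h \<in> carrier E" "k \<in> carrier E" and [measurable]: "\<phi> \<in> borel_measurable M"
      and \<phi>: "AE w in M. 0 \<le> \<phi> w \<and> \<phi> w \<le> 1"
    let ?h = "x \<oplus>\<^bsub>E\<^esub> h" and ?k = "x \<oplus>\<^bsub>E\<^esub> k"
    have c: "?h \<in> carrier E" "?k \<in> carrier E" using x hk by auto
    have "sc \<phi> ?h \<oplus>\<^bsub>E\<^esub> sc (\<lambda>w. 1 - \<phi> w) ?k
        = (sc \<phi> x \<oplus>\<^bsub>E\<^esub> sc (\<lambda>w. 1 - \<phi> w) x) \<oplus>\<^bsub>E\<^esub> (sc \<phi> h \<oplus>\<^bsub>E\<^esub> sc (\<lambda>w. 1 - \<phi> w) k)"
      using x hk by (simp add: sc_add_right add_swap)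
    also have "\<dots> = x \<oplus>\<^bsub>E\<^esub> (sc \<phi> h \<oplus>\<^bsub>E\<^esub> sc (\<lambda>w. 1 - \<phi> w) k)"
      using x by (simp add: sc_add_left)
    finally have eq: "sc \<phi> ?h \<oplus>\<^bsub>E\<^esub> sc (\<lambda>w. 1 - \<phi> w) ?k = x \<oplus>\<^bsub>E\<^esub> (sc \<phi> h \<oplus>\<^bsub>E\<^esub> sc (\<lambda>w. 1 - \<phi> w) k)" .
    have pos: "ae_class M \<phi> \<in> L0_pos M" "L0_le M (ae_class M \<phi>) \<one>\<^bsub>L0 M\<^esub>"
      using \<phi> by (auto simp: L0_pos_def L0_zero L0_one L0_rel_ae_class)
    have sum: "ae_class M \<phi> \<odot>\<^bsub>E\<^esub> ?h \<oplus>\<^bsub>E\<^esub> (\<one>\<^bsub>L0 M\<^esub> \<ominus>\<^bsub>L0 M\<^esub> ae_class M \<phi>) \<odot>\<^bsub>E\<^esub> ?k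
        = sc \<phi> ?h \<oplus>\<^bsub>E\<^esub> sc (\<lambda>w. 1 - \<phi> w) ?k"
      by (simp add: sc_def L0_one L0_minus_ae_class)
    have c': "sc \<phi> ?h \<oplus>\<^bsub>E\<^esub> sc (\<lambda>w. 1 - \<phi> w) ?k \<in> carrier E" using c by auto
    have "L0_le M (f (sc \<phi> ?h \<oplus>\<^bsub>E\<^esub> sc (\<lambda>w. 1 - \<phi> w) ?k))
        (L0_map2 M (+) (L0_map2 M (*) (L0_embed M (ae_class M \<phi>)) (f ?h))
          (L0_map2 M (*) (L0_embed M (\<one>\<^bsub>L0 M\<^esub> \<ominus>\<^bsub>L0 M\<^esub> ae_class M \<phi>)) (f ?k)))"
      using convex c pos unfolding L0_convex_fun_def sum[symmetric] by blast
    then have "AE w in M. F (sc \<phi> ?h \<oplus>\<^bsub>E\<^esub> sc (\<lambda>w. 1 - \<phi> w) ?k) w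
        \<le> ereal (\<phi> w) * F ?h w + ereal (1 - \<phi> w) * F ?k w"
      using F[OF c(1)] F[OF c(2)] F[OF c'] c c'
      by (simp add: f L0_embed_def L0_one L0_minus_ae_class L0_map_ae_class L0_map2_ae_class
          L0_rel_ae_class)
    with not_MInf[OF c(1)] not_MInf[OF c(2)] fin \<phi>
    show "AE w in M. F (x \<oplus>\<^bsub>E\<^esub> (sc \<phi> h \<oplus>\<^bsub>E\<^esub> sc (\<lambda>w. 1 - \<phi> w) k)) w - F x w
        \<le> ereal (\<phi> w) * (F ?h w - F x w) + ereal (1 - \<phi> w) * (F ?k w - F x w)"
      unfolding eq
    proof eventually_elim
      case (elim w)
      then obtain r where r: "F x w = ereal r" by (cases "F x w") auto
      have "F (x \<oplus>\<^bsub>E\<^esub> (sc \<phi> h \<oplus>\<^bsub>E\<^esub> sc (\<lambda>w. 1 - \<phi> w) k)) w - F x w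
          \<le> (ereal (\<phi> w) * F ?h w + ereal (1 - \<phi> w) * F ?k w) - F x w"
        using elim by (intro ereal_minus_mono) auto
      \<comment> \<open>The weights sum to 1, so the real value of \<open>F x w\<close> can be
        shared between the two terms; neither term is -\<infinity>, so infinities of opposite sign
        never meet.\<close>
      also have "\<dots> = ereal (\<phi> w) * (F ?h w - F x w) + ereal (1 - \<phi> w) * (F ?k w - F x w)"
        using elim by (cases "F ?h w"; cases "F ?k w") (auto simp: r algebra_simps)
      finally show ?case .
    qed
  next
    fix h assume h: "h \<in> carrier E"
    obtain U where U: "openin T U" "x \<in> U" "U \<subseteq> L0_dom M E f"
      using x_int by (auto simp: interior_of_def)
    have "openin (L0_topology M) {\<eta> \<in> topspace (L0_topology M). x \<oplus>\<^bsub>E\<^esub> \<eta> \<odot>\<^bsub>E\<^esub> h \<in> U}"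
      by (rule openin_continuous_map_preimage[OF continuous_line[OF x h] U(1)])
    moreover have "\<zero>\<^bsub>L0 M\<^esub> \<in> {\<eta> \<in> topspace (L0_topology M). x \<oplus>\<^bsub>E\<^esub> \<eta> \<odot>\<^bsub>E\<^esub> h \<in> U}"
      using U x h by simp
    ultimately obtain \<epsilon> where "\<epsilon> \<in> L0_spos M"
      "L0_cball M \<zero>\<^bsub>L0 M\<^esub> \<epsilon> \<subseteq> {\<eta> \<in> topspace (L0_topology M). x \<oplus>\<^bsub>E\<^esub> \<eta> \<odot>\<^bsub>E\<^esub> h \<in> U}"
      unfolding openin_L0_topology by blast
    then obtain e where e [measurable]: "e \<in> borel_measurable M" and pos: "\<And>w. 0 < e w"
      and ball: "L0_cball M (ae_class M (\<lambda>_. 0)) (ae_class M e)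
        \<subseteq> {\<eta> \<in> topspace (L0_topology M). x \<oplus>\<^bsub>E\<^esub> \<eta> \<odot>\<^bsub>E\<^esub> h \<in> U}"
      by (auto simp: L0_zero elim: L0_sposE)
    have "AE w in M. F (x \<oplus>\<^bsub>E\<^esub> sc \<phi> h) w - F x w < \<infinity>"
      if [measurable]: "\<phi> \<in> borel_measurable M" and \<phi>: "\<And>w. \<bar>\<phi> w\<bar> \<le> e w" for \<phi>
    proof -
      have "ae_class M \<phi> \<in> L0_cball M (ae_class M (\<lambda>_. 0)) (ae_class M e)"
        using \<phi> by (simp add: L0_cball_ae_class)
      then have "x \<oplus>\<^bsub>E\<^esub> sc \<phi> h \<in> L0_dom M E f" using ball U(3) by (auto simp: sc_def)
      moreover have c: "x \<oplus>\<^bsub>E\<^esub> sc \<phi> h \<in> carrier E" using x h by auto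
      ultimately have "AE w in M. \<bar>F (x \<oplus>\<^bsub>E\<^esub> sc \<phi> h) w\<bar> < \<infinity>"
        using L0_dom_iff[where f = f, OF F[OF c] f[OF c] c] by simp
      with fin show ?thesis
      proof eventually_elim
        case (elim w)
        then show ?case by (cases "F (x \<oplus>\<^bsub>E\<^esub> sc \<phi> h) w"; cases "F x w") auto
      qed
    qed
    from this[of e] this[of "\<lambda>w. - e w"] show "\<exists>\<epsilon>\<in>borel_measurable M. (\<forall>w. 0 < \<epsilon> w) \<and>
        (AE w in M. F (x \<oplus>\<^bsub>E\<^esub> sc \<epsilon> h) w - F x w < \<infinity>) \<and>
        (AE w in M. F (x \<oplus>\<^bsub>E\<^esub> sc (\<lambda>w. - \<epsilon> w) h) w - F x w < \<infinity>)"
      using pos by (intro bexI[of _ e]) (auto simp: abs_of_pos)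
  }
qed

end

theorem theorem3p45:
  fixes M :: "'w measure"
    and E :: "(('w \<Rightarrow> real) set, 'e, 'm) module_scheme"
    and T :: "'e topology"
    and f :: "'e \<Rightarrow> ('w \<Rightarrow> ereal) set"
  assumes "L0_pre_barreled_module M E T"
    and "countable_concatenation M E (carrier E)"
    and "f \<in> carrier E \<rightarrow> L0_space M"
    and "L0_proper M E f"
    and "L0_lsc M E T f"
    and "L0_convex_fun M E f"
  shows "\<forall>x \<in> T interior_of L0_dom M E f. subdifferential M E T f x \<noteq> {}"
proof
  interpret L0_pre_barreled_module M E T by (fact assms(1))
  fix x assume x_int: "x \<in> T interior_of L0_dom M E f"
  then have x_dom: "x \<in> L0_dom M E f" using interior_of_subset by (metis subsetD)
  then have x: "x \<in> carrier E" by (simp add: L0_dom_def)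
  have "\<forall>z\<in>carrier E. \<exists>\<phi>. \<phi> \<in> borel_measurable M \<and> f z = ae_class M \<phi>"
    using assms(3) by (force simp: L0_space_def)
  then obtain F where F [measurable]: "\<And>z. z \<in> carrier E \<Longrightarrow> F z \<in> borel_measurable M"
    and f: "\<And>z. z \<in> carrier E \<Longrightarrow> f z = ae_class M (F z)"
    by metis
  define g where "g h w = F (x \<oplus>\<^bsub>E\<^esub> h) w - F x w" for h w
  interpret g: L0_convex_germ M E g
    unfolding g_def[abs_def] by (rule L0_convex_germ_interior[OF F f assms(4,6) x_int])
  have fin: "AE w in M. \<bar>F x w\<bar> < \<infinity>" using x_dom L0_dom_iff F f x by blast
  \<comment> \<open>Adding 1 to the value at \<open>x\<close> turns the unit sublevel set of
    \<open>g\<close> into a translate of a sublevel set of \<open>f\<close> at a random level, to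
    which lower semicontinuity applies.\<close>
  define r where "r = (\<lambda>w. real_of_ereal (F x w) + 1)"
  have [measurable]: "r \<in> borel_measurable M" unfolding r_def using x by measurable
  define S where "S = {z \<in> carrier E. L0_le M (f z) (L0_embed M (ae_class M r))}"
  have S: "closedin T S" unfolding S_def using assms(5) by (simp add: L0_lsc_def)
  have S_iff: "(AE w in M. g h w \<le> 1) \<longleftrightarrow> x \<oplus>\<^bsub>E\<^esub> h \<in> S" if h: "h \<in> carrier E" for h
  proof -
    have "x \<oplus>\<^bsub>E\<^esub> h \<in> S \<longleftrightarrow> (AE w in M. F (x \<oplus>\<^bsub>E\<^esub> h) w \<le> ereal (r w))"
      using x h by (simp add: S_def f L0_embed_def L0_map_ae_class L0_rel_ae_class)
    moreover have "AE w in M. g h w \<le> 1 \<longleftrightarrow> F (x \<oplus>\<^bsub>E\<^esub> h) w \<le> ereal (r w)"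
      using fin
    proof eventually_elim
      case (elim w)
      then show ?case
        by (cases "F x w"; cases "F (x \<oplus>\<^bsub>E\<^esub> h) w") (auto simp: g_def r_def one_ereal_def)
    qed
    then have "(AE w in M. g h w \<le> 1) \<longleftrightarrow> (AE w in M. F (x \<oplus>\<^bsub>E\<^esub> h) w \<le> ereal (r w))"
      by (rule eventually_subst)
    ultimately show ?thesis by simp
  qed
  \<comment> \<open>Both conditions are preimages of the closed set \<open>S\<close> under affine
    maps, with scalars 1 and -1.\<close>
  have "g.unit_sublevel = {h \<in> topspace T. x \<oplus>\<^bsub>E\<^esub> ae_class M (\<lambda>_. 1) \<odot>\<^bsub>E\<^esub> h \<in> S} \<inter>
      {h \<in> topspace T. x \<oplus>\<^bsub>E\<^esub> ae_class M (\<lambda>_. -1) \<odot>\<^bsub>E\<^esub> h \<in> S}"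
    by (auto simp: g.unit_sublevel_def S_iff topspace_carrier sc_def[symmetric])
  also have "closedin T \<dots>"
    by (intro closedin_Int closedin_continuous_map_preimage[OF continuous_affine S]) (use x in auto)
  finally have "L0_barrel M E T g.unit_sublevel"
    by (simp add: L0_barrel_def g.L0_balanced_unit_sublevel g.L0_absorbent_unit_sublevel
        g.L0_convex_unit_sublevel)
  from barrel_neighbourhood[OF this g.countable_concatenation_unit_sublevel[OF assms(2)]]
  have nbhd: "\<zero>\<^bsub>E\<^esub> \<in> T interior_of g.unit_sublevel" .
  obtain v where v: "\<And>h. h \<in> carrier E \<Longrightarrow> v h \<in> borel_measurable M"
    and v_add: "\<And>h k. h \<in> carrier E \<Longrightarrow> k \<in> carrier E \<Longrightarrow> AE w in M. v (h \<oplus>\<^bsub>E\<^esub> k) w = v h w + v k w"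
    and v_sc: "\<And>h \<phi>. h \<in> carrier E \<Longrightarrow> \<phi> \<in> borel_measurable M \<Longrightarrow>
      AE w in M. v (sc \<phi> h) w = \<phi> w * v h w"
    and v_le: "\<And>h. h \<in> carrier E \<Longrightarrow> AE w in M. ereal (v h w) \<le> g h w"
    using g.hahn_banach by blast
  have bound: "AE w in M. \<bar>v h w\<bar> \<le> 1" if "h \<in> g.unit_sublevel" for h
  proof -
    have h: "h \<in> carrier E" and le: "AE w in M. g h w \<le> 1" "AE w in M. g (sc (\<lambda>_. -1) h) w \<le> 1"
      using that by (auto simp: g.unit_sublevel_def)
    \<comment> \<open>The upper bound at the negative of \<open>h\<close> becomes the lower bound
      for \<open>v h\<close>.\<close>
    have "AE w in M. v (sc (\<lambda>_. -1) h) w = -1 * v h w" by (rule v_sc[OF h]) simp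
    moreover have "AE w in M. ereal (v (sc (\<lambda>_. -1) h) w) \<le> g (sc (\<lambda>_. -1) h) w"
      by (rule v_le) (use h in auto)
    ultimately show ?thesis
      using le v_le[OF h]
    proof eventually_elim
      case (elim w)
      have "ereal (v h w) \<le> 1" "ereal (v (sc (\<lambda>_. -1) h) w) \<le> 1"
        by (rule order_trans; fact elim)+
      then show ?case using elim(1) by (simp add: one_ereal_def abs_le_iff)
    qed
  qed
  have "(\<lambda>h. ae_class M (v h)) \<in> L0_dual M E T"
    using v v_add v_sc nbhd bound by (rule L0_dual_bounded)
  moreover have "L0_le M (L0_embed M (ae_class M (v (y \<ominus>\<^bsub>E\<^esub> x)))) (L0_map2 M (-) (f y) (f x))"
    if y: "y \<in> carrier E" for y
  proof -
    have d: "y \<ominus>\<^bsub>E\<^esub> x \<in> carrier E" using x y by simp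
    have "x \<oplus>\<^bsub>E\<^esub> (y \<ominus>\<^bsub>E\<^esub> x) = y"
      using x y by (simp add: a_minus_def M.add.m_lcomm[of x y] M.r_neg)
    then have "AE w in M. ereal (v (y \<ominus>\<^bsub>E\<^esub> x) w) \<le> F y w - F x w"
      using v_le[OF d] by (simp add: g_def)
    then show ?thesis
      using x y d v by (simp add: f L0_embed_def L0_map_ae_class L0_map2_ae_class L0_rel_ae_class)
  qed
  ultimately show "subdifferential M E T f x \<noteq> {}"
    unfolding subdifferential_def by blast
qed

end
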